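(* Let $s\ge 1$. The $s$-tuples $(P_1,\ldots,P_s)$ of points of $\mathbb{P}^{n_1}\times\cdots\times\mathbb{P}^{n_k}$, considered as points of $(\mathbb{P}^{n_1}\times\cdots\times\mathbb{P}^{n_k})^s$, which are in generic position form a non-empty open subset of $(\mathbb{P}^{n_1}\times\cdots\times\mathbb{P}^{n_k})^s$ (in the Zariski topology).
   Context: $\mathbf{k}$ is an algebraically closed field of characteristic $0$; $\mathbb{N}=\{0,1,2,\ldots\}$; $k\ge 1$ and $n_1,\ldots,n_k\ge 1$ are integers; $e_1,\ldots,e_k$ is the standard basis of $\mathbb{N}^k$. $R=\mathbf{k}[x_{l,m} : 1\le l\le k,\ 0\le m\le n_l]$ is $\mathbb{N}^k$-graded by $\deg x_{l,m}=e_l$; it is the coordinate ring of $\mathbb{P}^{n_1}\times\cdots\times\mathbb{P}^{n_k}$ over $\mathbf{k}$. $N(\underline{j})=\dim_{\mathbf{k}}R_{\underline{j}}=\prod_{l=1}^k\binom{n_l+j_l}{j_l}$. For a nonempty finite set $\mathbb{X}$ of points, $I_{\mathbb{X}}\subseteq R$ is the ideal generated by the $\mathbb{N}^k$-homogeneous forms vanishing at every point of $\mathbb{X}$, and $H_{\mathbb{X}}(\underline{j})=\dim_{\mathbf{k}}(R/I_{\mathbb{X}})_{\underline{j}}$. A set $\mathbb{X}$ of $s$ (distinct) points is in generic position if $H_{\mathbb{X}}(\underline{j})=\min\{N(\underline{j}),s\}$ for all $\underline{j}\in\mathbb{N}^k$; an $s$-tuple $(P_1,\ldots,P_s)$ is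 in generic position if its entries are $s$ distinct points forming a set in generic position. $(\mathbb{P}^{n_1}\times\cdots\times\mathbb{P}^{n_k})^s$ is the $s$-fold product variety. *)

theory Defs
  imports
    "HOL-Library.Poly_Mapping"
    "HOL-Algebra.Embedded_Algebras"
    "HOL-Algebra.QuotRing"
    "HOL-Analysis.Abstract_Topology"
    "HOL-Computational_Algebra.Polynomial"
begin

section \<open>The multigraded coordinate ring\<close>

text \<open>
  Products of projective spaces are indexed by an arbitrary finite set \<open>L\<close> of factors, with
  \<open>n l\<close> the dimension of the factor \<open>l\<close>. The set \<open>L = {1..k}\<close> gives the ambient variety;
  \<open>L = {1..s} \<times> {1..k}\<close> gives its \<open>s\<close>-fold product, whose Zariski topology needs polynomials that are
  homogeneous in each of the \<open>s * k\<close> blocks of variables.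

  The pair \<open>(l, m)\<close> stands for the variable \<open>x\<^sub>l\<^sub>,\<^sub>m\<close>. A monomial is a finitely supported map from
  variables to exponents, and a polynomial a finitely supported map from monomials to coefficients.
\<close>

type_synonym ('l, 'a) mpoly = "(('l \<times> nat) \<Rightarrow>\<^sub>0 nat) \<Rightarrow>\<^sub>0 'a"

definition vars :: "'l set \<Rightarrow> ('l \<Rightarrow> nat) \<Rightarrow> ('l \<times> nat) set" where
  "vars L n = (SIGMA l:L. {0..n l})"

definition coord_ring :: "'l set \<Rightarrow> ('l \<Rightarrow> nat) \<Rightarrow> ('l, 'a::field) mpoly ring" where
  "coord_ring L n =
     \<lparr>carrier = {f. \<forall>\<mu>\<in>Poly_Mapping.keys f. Poly_Mapping.keys \<mu> \<subseteq> vars L n},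
      monoid.mult = (*), one = 1, zero = 0, add = (+)\<rparr>"

definition constants :: "('l, 'a::field) mpoly set" where
  "constants = range (Poly_Mapping.single 0)"

text \<open>Multidegrees are extensional functions on \<open>L\<close>, so that \<open>multidegrees {1..k}\<close> is \<open>\<nat>\<^sup>k\<close>.\<close>

definition multidegrees :: "'l set \<Rightarrow> ('l \<Rightarrow> nat) set" where
  "multidegrees L = (L \<rightarrow>\<^sub>E UNIV)"

definition graded_piece :: "'l set \<Rightarrow> ('l \<Rightarrow> nat) \<Rightarrow> ('l \<Rightarrow> nat) \<Rightarrow> ('l, 'a::field) mpoly set" where
  "graded_piece L n j =
     {f \<in> carrier (coord_ring L n).
        \<forall>\<mu>\<in>Poly_Mapping.keys f. \<forall>l\<in>L. (\<Sum>m = 0..n l. Poly_Mapping.lookup \<mu> (l, m)) = j l}"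

definition forms :: "'l set \<Rightarrow> ('l \<Rightarrow> nat) \<Rightarrow> ('l, 'a::field) mpoly set" where
  "forms L n = (\<Union>j\<in>multidegrees L. graded_piece L n j)"

definition eval_mpoly :: "('l \<Rightarrow> nat \<Rightarrow> 'a) \<Rightarrow> ('l, 'a::field) mpoly \<Rightarrow> 'a" where
  "eval_mpoly v f =
     (\<Sum>\<mu>\<in>Poly_Mapping.keys f. Poly_Mapping.lookup f \<mu> *
        (\<Prod>(l, m)\<in>Poly_Mapping.keys \<mu>. v l m ^ Poly_Mapping.lookup \<mu> (l, m)))"


section \<open>Products of projective spaces and the Zariski topology\<close>

text \<open>The nonzero vectors of the \<open>(d + 1)\<close>-dimensional coordinate space, with coordinates \<open>0, \<dots>, d\<close>.\<close>

definition nonzero_vecs :: "nat \<Rightarrow> (nat \<Rightarrow> 'a::field) set" where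
  "nonzero_vecs d = {v. (\<forall>m>d. v m = 0) \<and> (\<exists>m. v m \<noteq> 0)}"

definition proportional :: "nat \<Rightarrow> ((nat \<Rightarrow> 'a::field) \<times> (nat \<Rightarrow> 'a)) set" where
  "proportional d =
     {(v, w). v \<in> nonzero_vecs d \<and> w \<in> nonzero_vecs d \<and> (\<exists>c. c \<noteq> 0 \<and> w = (\<lambda>m. c * v m))}"

definition proj_space :: "nat \<Rightarrow> (nat \<Rightarrow> 'a::field) set set" where
  "proj_space d = nonzero_vecs d // proportional d"

definition multiproj :: "'l set \<Rightarrow> ('l \<Rightarrow> nat) \<Rightarrow> ('l \<Rightarrow> (nat \<Rightarrow> 'a::field) set) set" where
  "multiproj L n = (\<Pi>\<^sub>E l\<in>L. proj_space (n l))"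

text \<open>
  Vanishing is required for all choices of homogeneous coordinates of the point;
  for a form it does not depend on the choice.
\<close>

definition vanishes_at :: "'l set \<Rightarrow> ('l, 'a::field) mpoly \<Rightarrow> ('l \<Rightarrow> (nat \<Rightarrow> 'a) set) \<Rightarrow> bool" where
  "vanishes_at L f P \<longleftrightarrow> (\<forall>v. (\<forall>l\<in>L. v l \<in> P l) \<longrightarrow> eval_mpoly v f = 0)"

definition zero_locus ::
    "'l set \<Rightarrow> ('l \<Rightarrow> nat) \<Rightarrow> ('l, 'a::field) mpoly set \<Rightarrow> ('l \<Rightarrow> (nat \<Rightarrow> 'a) set) set" where
  "zero_locus L n F = {P \<in> multiproj L n. \<forall>f\<in>F. vanishes_at L f P}"

definition zariski :: "'l set \<Rightarrow> ('l \<Rightarrow> nat) \<Rightarrow> ('l \<Rightarrow> (nat \<Rightarrow> 'a::field) set) topology" where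
  "zariski L n =
     topology (\<lambda>U. \<exists>F. F \<subseteq> forms L n \<and> U = multiproj L n - zero_locus L n F)"

text \<open>
  An \<open>s\<close>-tuple of points of \<open>multiproj L n\<close> is the same as a point of the product of projective
  spaces indexed by \<open>{1..s} \<times> L\<close>; the Zariski topology of the product variety is transported
  along this bijection (it is not the product topology).
\<close>

definition point_tuples ::
    "nat \<Rightarrow> 'l set \<Rightarrow> ('l \<Rightarrow> nat) \<Rightarrow> (nat \<Rightarrow> 'l \<Rightarrow> (nat \<Rightarrow> 'a::field) set) set" where
  "point_tuples s L n = ({1..s} \<rightarrow>\<^sub>E multiproj L n)"

definition flatten_tuple ::
    "nat \<Rightarrow> 'l set \<Rightarrow> (nat \<Rightarrow> 'l \<Rightarrow> (nat \<Rightarrow> 'a::field) set) \<Rightarrow> (nat \<times> 'l \<Rightarrow> (nat \<Rightarrow> 'a) set)" where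
  "flatten_tuple s L P = (\<lambda>(i, l)\<in>{1..s} \<times> L. P i l)"

definition zariski_power ::
    "nat \<Rightarrow> 'l set \<Rightarrow> ('l \<Rightarrow> nat) \<Rightarrow> (nat \<Rightarrow> 'l \<Rightarrow> (nat \<Rightarrow> 'a::field) set) topology" where
  "zariski_power s L n =
     pullback_topology (point_tuples s L n) (flatten_tuple s L)
       (zariski ({1..s} \<times> L) (\<lambda>(i, l). n l))"


section \<open>Hilbert functions and generic position\<close>

definition vanishing_ideal ::
    "'l set \<Rightarrow> ('l \<Rightarrow> nat) \<Rightarrow> ('l \<Rightarrow> (nat \<Rightarrow> 'a::field) set) set \<Rightarrow> ('l, 'a) mpoly set" where
  "vanishing_ideal L n X =
     Idl\<^bsub>coord_ring L n\<^esub> {f \<in> forms L n. \<forall>P\<in>X. vanishes_at L f P}"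

text \<open>
  The dimension over the ground field of a graded piece of the coordinate ring. The ground field is
  the set of constant polynomials.
\<close>

definition ring_hilbert :: "'a::field itself \<Rightarrow> 'l set \<Rightarrow> ('l \<Rightarrow> nat) \<Rightarrow> ('l \<Rightarrow> nat) \<Rightarrow> nat" where
  "ring_hilbert _ L n j =
     ring.dim (coord_ring L n) constants (graded_piece L n j :: ('l, 'a) mpoly set)"

text \<open>
  The ground field and the graded pieces of the quotient ring are the images of those of the
  coordinate ring under the canonical projection.
\<close>

definition hilbert ::
    "'l set \<Rightarrow> ('l \<Rightarrow> nat) \<Rightarrow> ('l \<Rightarrow> (nat \<Rightarrow> 'a::field) set) set \<Rightarrow> ('l \<Rightarrow> nat) \<Rightarrow> nat" where
  "hilbert L n X j =
     (let R = coord_ring L n; I = vanishing_ideal L n X; proj = (\<lambda>f. I +>\<^bsub>R\<^esub> f)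
      in ring.dim (R Quot I) (proj ` constants) (proj ` graded_piece L n j))"

definition generic_position ::
    "'l set \<Rightarrow> ('l \<Rightarrow> nat) \<Rightarrow> ('l \<Rightarrow> (nat \<Rightarrow> 'a::field) set) set \<Rightarrow> bool" where
  "generic_position L n X \<longleftrightarrow>
     finite X \<and> X \<noteq> {} \<and> X \<subseteq> multiproj L n \<and>
     (\<forall>j\<in>multidegrees L. hilbert L n X j = min (ring_hilbert TYPE('a) L n j) (card X))"

definition generic_tuple ::
    "nat \<Rightarrow> 'l set \<Rightarrow> ('l \<Rightarrow> nat) \<Rightarrow> (nat \<Rightarrow> 'l \<Rightarrow> (nat \<Rightarrow> 'a::field) set) \<Rightarrow> bool" where
  "generic_tuple s L n P \<longleftrightarrow>
     P \<in> point_tuples s L n \<and> inj_on P {1..s} \<and> generic_position L n (P ` {1..s})"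


section \<open>Well-definedness\<close>

subsection \<open>The coordinate ring is a ring\<close>

lemma carrier_coord_ring:
  "carrier (coord_ring L n) = {f. \<forall>\<mu>\<in>Poly_Mapping.keys f. Poly_Mapping.keys \<mu> \<subseteq> vars L n}"
  by (simp add: coord_ring_def)

lemma keys_add_nat:
  "Poly_Mapping.keys (\<mu> + \<nu> :: 'b \<Rightarrow>\<^sub>0 nat) = Poly_Mapping.keys \<mu> \<union> Poly_Mapping.keys \<nu>"
  by (auto simp: in_keys_iff lookup_add)

lemma carrier_add:
  "f \<in> carrier (coord_ring L n) \<Longrightarrow> g \<in> carrier (coord_ring L n) \<Longrightarrow> f + g \<in> carrier (coord_ring L n)"
  using Poly_Mapping.keys_add[of f g] by (auto simp: carrier_coord_ring subset_iff)

lemma carrier_mult: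
  assumes "f \<in> carrier (coord_ring L n)" "g \<in> carrier (coord_ring L n)"
  shows "f * g \<in> carrier (coord_ring L n)"
proof -
  have "Poly_Mapping.keys \<mu> \<subseteq> vars L n" if "\<mu> \<in> Poly_Mapping.keys (f * g)" for \<mu>
  proof -
    obtain a b where "\<mu> = a + b" "a \<in> Poly_Mapping.keys f" "b \<in> Poly_Mapping.keys g"
      using \<open>\<mu> \<in> Poly_Mapping.keys (f * g)\<close> keys_mult[of f g] by blast
    then show ?thesis
      using assms by (auto simp: carrier_coord_ring keys_add_nat)
  qed
  then show ?thesis
    by (simp add: carrier_coord_ring)
qed

lemma carrier_uminus:
  "f \<in> carrier (coord_ring L n) \<Longrightarrow> - f \<in> carrier (coord_ring L n)"
  by (simp add: carrier_coord_ring in_keys_iff)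

lemma cring_coord_ring: "cring (coord_ring L n :: ('l, 'a::field) mpoly ring)"
proof (rule cringI)
  show "abelian_group (coord_ring L n :: ('l, 'a) mpoly ring)"
  proof (rule abelian_groupI)
    fix x :: "('l, 'a) mpoly" assume "x \<in> carrier (coord_ring L n)"
    then show "\<exists>y\<in>carrier (coord_ring L n). y \<oplus>\<^bsub>coord_ring L n\<^esub> x = \<zero>\<^bsub>coord_ring L n\<^esub>"
      by (intro bexI[of _ "- x"]) (simp_all add: carrier_uminus, simp add: coord_ring_def)
  next
    fix x y :: "('l, 'a) mpoly"
    assume "x \<in> carrier (coord_ring L n)" "y \<in> carrier (coord_ring L n)"
    then show "x \<oplus>\<^bsub>coord_ring L n\<^esub> y \<in> carrier (coord_ring L n)"
      using carrier_add[of x L n y] by (simp add: coord_ring_def)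
  qed (auto simp: coord_ring_def algebra_simps)
  show "comm_monoid (coord_ring L n :: ('l, 'a) mpoly ring)"
  proof (rule comm_monoidI)
    fix x y :: "('l, 'a) mpoly"
    assume "x \<in> carrier (coord_ring L n)" "y \<in> carrier (coord_ring L n)"
    then show "x \<otimes>\<^bsub>coord_ring L n\<^esub> y \<in> carrier (coord_ring L n)"
      using carrier_mult[of x L n y] by (simp add: coord_ring_def)
  qed (auto simp: coord_ring_def algebra_simps)
qed (simp add: coord_ring_def algebra_simps)


subsection \<open>The Zariski topology is a topology\<close>

lemma eval_mpoly_superset:
  assumes "finite A" "Poly_Mapping.keys f \<subseteq> A"
  shows "eval_mpoly v f =
     (\<Sum>\<mu>\<in>A. Poly_Mapping.lookup f \<mu> *
        (\<Prod>(l, m)\<in>Poly_Mapping.keys \<mu>. v l m ^ Poly_Mapping.lookup \<mu> (l, m)))"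
  unfolding eval_mpoly_def
  by (rule sum.mono_neutral_left) (use assms in \<open>auto simp: in_keys_iff\<close>)

lemma monomial_add:
  fixes v :: "'l \<Rightarrow> nat \<Rightarrow> 'a::field" and \<mu> \<nu> :: "('l \<times> nat) \<Rightarrow>\<^sub>0 nat"
  shows "(\<Prod>(l, m)\<in>Poly_Mapping.keys (\<mu> + \<nu>). v l m ^ Poly_Mapping.lookup (\<mu> + \<nu>) (l, m)) =
     (\<Prod>(l, m)\<in>Poly_Mapping.keys \<mu>. v l m ^ Poly_Mapping.lookup \<mu> (l, m)) *
     (\<Prod>(l, m)\<in>Poly_Mapping.keys \<nu>. v l m ^ Poly_Mapping.lookup \<nu> (l, m))"
proof -
  let ?A = "Poly_Mapping.keys \<mu> \<union> Poly_Mapping.keys \<nu>"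
  have ext: "(\<Prod>(l, m)\<in>Poly_Mapping.keys \<rho>. v l m ^ Poly_Mapping.lookup \<rho> (l, m)) =
      (\<Prod>(l, m)\<in>?A. v l m ^ Poly_Mapping.lookup \<rho> (l, m))"
    if "Poly_Mapping.keys \<rho> \<subseteq> ?A" for \<rho>
    by (rule prod.mono_neutral_left) (use that in \<open>auto simp: in_keys_iff\<close>)
  have "(\<Prod>(l, m)\<in>?A. v l m ^ Poly_Mapping.lookup (\<mu> + \<nu>) (l, m)) =
     (\<Prod>(l, m)\<in>?A. v l m ^ Poly_Mapping.lookup \<mu> (l, m)) *
     (\<Prod>(l, m)\<in>?A. v l m ^ Poly_Mapping.lookup \<nu> (l, m))"
    by (simp add: lookup_add power_add case_prod_beta prod.distrib)
  then show ?thesis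
    using ext[of \<mu>] ext[of \<nu>] by (simp add: keys_add_nat)
qed

lemma eval_mpoly_0 [simp]: "eval_mpoly v 0 = 0"
  by (simp add: eval_mpoly_def)

lemma eval_mpoly_1 [simp]: "eval_mpoly v 1 = 1"
  by (simp add: eval_mpoly_def lookup_one)

lemma eval_mpoly_single:
  "eval_mpoly v (Poly_Mapping.single \<mu> c) =
     c * (\<Prod>(l, m)\<in>Poly_Mapping.keys \<mu>. v l m ^ Poly_Mapping.lookup \<mu> (l, m))"
  by (simp add: eval_mpoly_def)

lemma eval_mpoly_add: "eval_mpoly v (f + g) = eval_mpoly v f + eval_mpoly v g"
proof -
  let ?A = "Poly_Mapping.keys f \<union> Poly_Mapping.keys g"
  have *: "finite ?A" "Poly_Mapping.keys f \<subseteq> ?A" "Poly_Mapping.keys g \<subseteq> ?A"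
    "Poly_Mapping.keys (f + g) \<subseteq> ?A"
    using Poly_Mapping.keys_add[of f g] by auto
  show ?thesis
    unfolding eval_mpoly_superset[OF *(1,2)] eval_mpoly_superset[OF *(1,3)]
      eval_mpoly_superset[OF *(1,4)]
    by (simp add: lookup_add distrib_right sum.distrib)
qed

lemma eval_mpoly_sum: "eval_mpoly v (\<Sum>i\<in>A. f i) = (\<Sum>i\<in>A. eval_mpoly v (f i))"
  by (induction A rule: infinite_finite_induct) (simp_all add: eval_mpoly_add)

lemma poly_mapping_expansion:
  "f = (\<Sum>\<mu>\<in>Poly_Mapping.keys f. Poly_Mapping.single \<mu> (Poly_Mapping.lookup f \<mu>))"
  by (rule poly_mapping_eqI)
    (simp add: lookup_sum lookup_single when_def in_keys_iff)

lemma eval_mpoly_mult: "eval_mpoly v (f * g) = eval_mpoly v f * eval_mpoly v g"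
proof -
  let ?s = "\<lambda>h \<mu>. Poly_Mapping.single \<mu> (Poly_Mapping.lookup h \<mu>)"
  have "f * g = (\<Sum>\<mu>\<in>Poly_Mapping.keys f. \<Sum>\<nu>\<in>Poly_Mapping.keys g. ?s f \<mu> * ?s g \<nu>)"
    by (subst poly_mapping_expansion[of f], subst poly_mapping_expansion[of g])
      (simp only: sum_product)
  then have "eval_mpoly v (f * g) =
      (\<Sum>\<mu>\<in>Poly_Mapping.keys f. \<Sum>\<nu>\<in>Poly_Mapping.keys g. eval_mpoly v (?s f \<mu>) * eval_mpoly v (?s g \<nu>))"
    by (simp add: eval_mpoly_sum mult_single eval_mpoly_single monomial_add mult_ac)
  also have "\<dots> = eval_mpoly v f * eval_mpoly v g"
    by (simp add: sum_product[symmetric] eval_mpoly_sum[symmetric] poly_mapping_expansion[symmetric])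
  finally show ?thesis .
qed

lemma eval_mpoly_scale:
  assumes "finite L" "f \<in> graded_piece L n j"
    and scale: "\<And>l. l \<in> L \<Longrightarrow> w l = (\<lambda>m. c l * v l m)"
  shows "eval_mpoly w f = (\<Prod>l\<in>L. c l ^ j l) * eval_mpoly v f"
proof -
  have "(\<Prod>(l, m)\<in>Poly_Mapping.keys \<mu>. w l m ^ Poly_Mapping.lookup \<mu> (l, m)) =
     (\<Prod>l\<in>L. c l ^ j l) * (\<Prod>(l, m)\<in>Poly_Mapping.keys \<mu>. v l m ^ Poly_Mapping.lookup \<mu> (l, m))"
    if "\<mu> \<in> Poly_Mapping.keys f" for \<mu>
  proof -
    have sub: "Poly_Mapping.keys \<mu> \<subseteq> vars L n"
      and deg: "\<And>l. l \<in> L \<Longrightarrow> (\<Sum>m = 0..n l. Poly_Mapping.lookup \<mu> (l, m)) = j l"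
      using assms(2) \<open>\<mu> \<in> Poly_Mapping.keys f\<close> by (auto simp: graded_piece_def carrier_coord_ring)
    have "(\<Prod>(l, m)\<in>Poly_Mapping.keys \<mu>. w l m ^ Poly_Mapping.lookup \<mu> (l, m)) =
        (\<Prod>(l, m)\<in>Poly_Mapping.keys \<mu>. (c l * v l m) ^ Poly_Mapping.lookup \<mu> (l, m))"
      by (rule prod.cong) (use sub scale in \<open>auto simp: vars_def\<close>)
    also have "\<dots> = (\<Prod>(l, m)\<in>Poly_Mapping.keys \<mu>. c l ^ Poly_Mapping.lookup \<mu> (l, m)) *
        (\<Prod>(l, m)\<in>Poly_Mapping.keys \<mu>. v l m ^ Poly_Mapping.lookup \<mu> (l, m))"
      by (simp add: power_mult_distrib case_prod_beta prod.distrib)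
    also have "(\<Prod>(l, m)\<in>Poly_Mapping.keys \<mu>. c l ^ Poly_Mapping.lookup \<mu> (l, m)) =
        (\<Prod>(l, m)\<in>vars L n. c l ^ Poly_Mapping.lookup \<mu> (l, m))"
      by (rule prod.mono_neutral_left)
        (use sub \<open>finite L\<close> in \<open>auto simp: vars_def in_keys_iff\<close>)
    also have "\<dots> = (\<Prod>l\<in>L. \<Prod>m = 0..n l. c l ^ Poly_Mapping.lookup \<mu> (l, m))"
      unfolding vars_def by (rule prod.Sigma[symmetric]) (use \<open>finite L\<close> in auto)
    also have "\<dots> = (\<Prod>l\<in>L. c l ^ j l)"
      by (rule prod.cong) (auto simp: power_sum[symmetric] deg)
    finally show ?thesis .
  qed
  then show ?thesis
    by (simp add: eval_mpoly_def sum_distrib_left mult_ac)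
qed

lemma forms_mult:
  assumes "f \<in> forms L n" "g \<in> forms L n"
  shows "f * g \<in> forms L n"
proof -
  obtain i j where i: "f \<in> graded_piece L n i" and j: "g \<in> graded_piece L n j"
    using assms by (auto simp: forms_def)
  have carr: "f * g \<in> carrier (coord_ring L n)"
    using carrier_mult i j by (auto simp: graded_piece_def)
  have "(\<Sum>m = 0..n l. Poly_Mapping.lookup \<mu> (l, m)) = i l + j l"
    if "\<mu> \<in> Poly_Mapping.keys (f * g)" "l \<in> L" for \<mu> l
  proof -
    obtain a b where ab: "\<mu> = a + b" "a \<in> Poly_Mapping.keys f" "b \<in> Poly_Mapping.keys g"
      using \<open>\<mu> \<in> Poly_Mapping.keys (f * g)\<close> keys_mult[of f g] by blast
    then show ?thesis
      using i j \<open>l \<in> L\<close> by (simp add: graded_piece_def lookup_add sum.distrib)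
  qed
  then have "f * g \<in> graded_piece L n (restrict (\<lambda>l. i l + j l) L)"
    using carr by (simp add: graded_piece_def)
  then show ?thesis
    by (auto simp: forms_def multidegrees_def)
qed

lemma one_in_forms: "1 \<in> forms L n"
proof -
  have "1 \<in> graded_piece L n (restrict (\<lambda>_. 0) L)"
    by (simp add: graded_piece_def carrier_coord_ring)
  then show ?thesis
    by (auto simp: forms_def multidegrees_def)
qed

lemma proj_space_scalar:
  assumes "p \<in> proj_space d" "v \<in> p" "w \<in> p"
  obtains c where "c \<noteq> 0" "w = (\<lambda>m. c * v m)"
proof -
  obtain u where p: "p = proportional d `` {u}"
    using assms(1) by (auto simp: proj_space_def elim: quotientE)
  obtain a b where "a \<noteq> 0" "v = (\<lambda>m. a * u m)" "b \<noteq> 0" "w = (\<lambda>m. b * u m)"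
    using assms(2,3) by (auto simp: p proportional_def)
  then show ?thesis
    by (intro that[of "b / a"]) auto
qed

lemma proj_space_nonempty:
  assumes "p \<in> proj_space d"
  obtains v where "v \<in> p"
proof -
  obtain u where u: "u \<in> nonzero_vecs d" "p = proportional d `` {u}"
    using assms by (auto simp: proj_space_def elim: quotientE)
  then have "u \<in> p"
    by (auto simp: proportional_def intro: exI[of _ 1])
  then show ?thesis
    using that by blast
qed

lemma vanishes_at_iff:
  assumes "finite L" "P \<in> multiproj L n" "f \<in> forms L n" "\<And>l. l \<in> L \<Longrightarrow> v l \<in> P l"
  shows "vanishes_at L f P \<longleftrightarrow> eval_mpoly v f = 0"
proof
  assume "eval_mpoly v f = 0"
  show "vanishes_at L f P"
    unfolding vanishes_at_def
  proof (intro allI impI)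
    fix w assume w: "\<forall>l\<in>L. w l \<in> P l"
    have "\<exists>c. w l = (\<lambda>m. c * v l m)" if "l \<in> L" for l
      using assms(2,4) w that proj_space_scalar[of "P l" "n l" "v l" "w l"]
      by (metis PiE_mem multiproj_def)
    then obtain c where c: "\<And>l. l \<in> L \<Longrightarrow> w l = (\<lambda>m. c l * v l m)"
      by metis
    obtain j where "f \<in> graded_piece L n j"
      using assms(3) by (auto simp: forms_def)
    from eval_mpoly_scale[OF assms(1) this, of w c v] c \<open>eval_mpoly v f = 0\<close>
    show "eval_mpoly w f = 0" by simp
  qed
qed (use assms in \<open>auto simp: vanishes_at_def\<close>)

lemma multiproj_coordinates:
  assumes "P \<in> multiproj L n"
  obtains v where "\<And>l. l \<in> L \<Longrightarrow> v l \<in> P l"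
proof -
  have "\<exists>x. x \<in> P l" if "l \<in> L" for l
    using assms that proj_space_nonempty[of "P l" "n l"] by (metis PiE_mem multiproj_def)
  then show ?thesis
    using that by metis
qed

lemma vanishes_at_mult:
  assumes "finite L" "P \<in> multiproj L n" "f \<in> forms L n" "g \<in> forms L n"
  shows "vanishes_at L (f * g) P \<longleftrightarrow> vanishes_at L f P \<or> vanishes_at L g P"
proof -
  obtain v where v: "\<And>l. l \<in> L \<Longrightarrow> v l \<in> P l"
    using multiproj_coordinates[OF assms(2)] by blast
  show ?thesis
    using vanishes_at_iff[OF assms(1,2) _ v] assms(3,4) forms_mult[OF assms(3,4)]
    by (simp add: eval_mpoly_mult)
qed

lemma istopology_zariski:
  fixes L :: "'l set" and n :: "'l \<Rightarrow> nat"
  assumes "finite L"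
  shows "istopology (\<lambda>U :: ('l \<Rightarrow> (nat \<Rightarrow> 'a::field) set) set.
           \<exists>F. F \<subseteq> forms L n \<and> U = multiproj L n - zero_locus L n F)"
proof -
  let ?M = "multiproj L n :: ('l \<Rightarrow> (nat \<Rightarrow> 'a) set) set"
  let ?V = "zero_locus L n :: ('l, 'a) mpoly set \<Rightarrow> _"
  show ?thesis
    unfolding istopology_def
  proof (intro conjI allI impI)
    fix S T :: "('l \<Rightarrow> (nat \<Rightarrow> 'a) set) set"
    assume "\<exists>F. F \<subseteq> forms L n \<and> S = ?M - ?V F" "\<exists>F. F \<subseteq> forms L n \<and> T = ?M - ?V F"
    then obtain F G where F: "F \<subseteq> forms L n" "S = ?M - ?V F" and G: "G \<subseteq> forms L n" "T = ?M - ?V G"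
      by blast
    let ?H = "{f * g | f g. f \<in> F \<and> g \<in> G}"
    have "?H \<subseteq> forms L n"
      using F G forms_mult by blast
    moreover have "S \<inter> T = ?M - ?V ?H"
    proof (rule Set.set_eqI)
      fix P :: "'l \<Rightarrow> (nat \<Rightarrow> 'a) set"
      show "P \<in> S \<inter> T \<longleftrightarrow> P \<in> ?M - ?V ?H"
      proof (cases "P \<in> ?M")
        case True
        have *: "vanishes_at L (f * g) P \<longleftrightarrow> vanishes_at L f P \<or> vanishes_at L g P"
          if "f \<in> F" "g \<in> G" for f g
          using vanishes_at_mult[OF assms True] F G that by blast
        have "P \<in> S \<inter> T \<longleftrightarrow> (\<exists>f\<in>F. \<exists>g\<in>G. \<not> vanishes_at L f P \<and> \<not> vanishes_at L g P)"
          using True F G by (auto simp: zero_locus_def)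
        also have "\<dots> \<longleftrightarrow> (\<exists>f\<in>F. \<exists>g\<in>G. \<not> vanishes_at L (f * g) P)"
          using * by blast
        also have "\<dots> \<longleftrightarrow> P \<in> ?M - ?V ?H"
          using True by (auto simp: zero_locus_def)
        finally show ?thesis .
      qed (use F in auto)
    qed
    ultimately show "\<exists>F. F \<subseteq> forms L n \<and> S \<inter> T = ?M - ?V F"
      by blast
  next
    fix K :: "('l \<Rightarrow> (nat \<Rightarrow> 'a) set) set set"
    assume K: "\<forall>S\<in>K. \<exists>F. F \<subseteq> forms L n \<and> S = ?M - ?V F"
    let ?G = "\<Union>{F. F \<subseteq> forms L n \<and> ?M - ?V F \<in> K}"
    have "\<Union>K = ?M - ?V ?G"
    proof
      show "\<Union>K \<subseteq> ?M - ?V ?G"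
      proof
        fix P assume "P \<in> \<Union>K"
        then obtain S where "S \<in> K" "P \<in> S" by blast
        moreover from this obtain F where "F \<subseteq> forms L n" "S = ?M - ?V F"
          using K by blast
        ultimately show "P \<in> ?M - ?V ?G"
          by (fastforce simp: zero_locus_def)
      qed
      show "?M - ?V ?G \<subseteq> \<Union>K"
      proof
        fix P assume P: "P \<in> ?M - ?V ?G"
        then obtain F f where "F \<subseteq> forms L n" "?M - ?V F \<in> K" "f \<in> F" "\<not> vanishes_at L f P"
          by (auto simp: zero_locus_def)
        then show "P \<in> \<Union>K"
          using P by (intro UnionI[of "?M - ?V F"]) (auto simp: zero_locus_def)
      qed
    qed
    then show "\<exists>F. F \<subseteq> forms L n \<and> \<Union>K = ?M - ?V F"
      by (intro exI[of _ ?G]) auto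
  qed
qed

lemma openin_zariski:
  assumes "finite L"
  shows "openin (zariski L n) U \<longleftrightarrow> (\<exists>F. F \<subseteq> forms L n \<and> U = multiproj L n - zero_locus L n F)"
  unfolding zariski_def by (simp add: topology_inverse'[OF istopology_zariski[OF assms]])

lemma topspace_zariski:
  fixes L :: "'l set"
  assumes "finite L"
  shows "topspace (zariski L n) = (multiproj L n :: ('l \<Rightarrow> (nat \<Rightarrow> 'a::field) set) set)"
proof
  let ?M = "multiproj L n :: ('l \<Rightarrow> (nat \<Rightarrow> 'a) set) set"
  have "\<not> vanishes_at L 1 P" if "P \<in> ?M" for P
    using multiproj_coordinates[OF that] by (metis eval_mpoly_1 vanishes_at_def zero_neq_one)
  then have "?M = ?M - zero_locus L n {1}"
    by (auto simp: zero_locus_def)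
  then have "openin (zariski L n) ?M"
    using openin_zariski[OF assms, of n ?M] one_in_forms[of L n] by blast
  then show "?M \<subseteq> topspace (zariski L n)"
    by (rule openin_subset)
  show "topspace (zariski L n) \<subseteq> ?M"
    using openin_topspace[of "zariski L n"] unfolding openin_zariski[OF assms] by blast
qed

lemma bij_betw_flatten_tuple:
  fixes L :: "'l set"
  shows "bij_betw (flatten_tuple s L) (point_tuples s L n :: (nat \<Rightarrow> 'l \<Rightarrow> (nat \<Rightarrow> 'a::field) set) set)
           (multiproj ({1..s} \<times> L) (\<lambda>(i, l). n l))"
proof -
  let ?f = "flatten_tuple s L :: (nat \<Rightarrow> 'l \<Rightarrow> (nat \<Rightarrow> 'a) set) \<Rightarrow> _"
  let ?g = "\<lambda>Q :: nat \<times> 'l \<Rightarrow> (nat \<Rightarrow> 'a) set. \<lambda>i\<in>{1..s}. \<lambda>l\<in>L. Q (i, l)"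
  let ?T = "point_tuples s L n :: (nat \<Rightarrow> 'l \<Rightarrow> (nat \<Rightarrow> 'a) set) set"
  let ?M = "multiproj ({1..s} \<times> L) (\<lambda>(i, l). n l) :: (nat \<times> 'l \<Rightarrow> (nat \<Rightarrow> 'a) set) set"
  have gf: "\<forall>P\<in>?T. ?g (?f P) = P"
  proof
    fix P assume P: "P \<in> ?T"
    have "?g (?f P) i l = P i l" for i l
    proof -
      have "P i \<in> extensional L" if "i \<in> {1..s}"
        using P that by (auto simp: point_tuples_def multiproj_def PiE_iff)
      moreover have "P \<in> extensional {1..s}"
        using P by (auto simp: point_tuples_def PiE_iff)
      ultimately show ?thesis
        by (auto simp: flatten_tuple_def restrict_def extensional_def)
    qed
    then show "?g (?f P) = P"
      by (intro HOL.ext)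
  qed
  have fg: "\<forall>Q\<in>?M. ?f (?g Q) = Q"
    by (auto simp: flatten_tuple_def multiproj_def PiE_iff extensional_def restrict_def fun_eq_iff)
  have f: "?f ` ?T \<subseteq> ?M"
  proof (rule image_subsetI)
    fix P assume "P \<in> ?T"
    then have "P i l \<in> proj_space (n l)" if "i \<in> {1..s}" "l \<in> L" for i l
      using that by (auto simp: point_tuples_def multiproj_def PiE_iff)
    then show "?f P \<in> ?M"
      unfolding flatten_tuple_def multiproj_def by (intro restrict_PiE_iff[THEN iffD2]) auto
  qed
  have g: "?g ` ?M \<subseteq> ?T"
    by (auto simp: multiproj_def point_tuples_def PiE_iff)
  show ?thesis
    using bij_betw_byWitness[OF gf fg f g] .
qed

lemma topspace_zariski_power:
  assumes "finite L"
  shows "topspace (zariski_power s L n) = point_tuples s L n"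
  unfolding zariski_power_def topspace_pullback_topology
  using bij_betw_flatten_tuple[of s L n] assms
  by (auto simp: topspace_zariski bij_betw_def)

end

(*
  Evaluation at the points of a tuple identifies the graded piece of degree j of R / I_X with the
  image of R_j in k^s, so generic position says that every evaluation map R_j -> k^s has maximal rank.
  Once j has an entry exceeding s, maximal rank means that the points are separated by forms of degree
  j, and this is inherited from a degree with all entries at most s; hence finitely many j suffice.
  For each j, rank at least r means that some r x r minor does not vanish, and the minors are
  multihomogeneous in the coordinates of the s points: this gives openness.  For non-emptiness, let
  the i-th point have the coordinates p^i for pairwise distinct primes p, one for each variable.
  By unique factorisation the evaluation matrices are Vandermonde matrices with distinct nodes.
*)
theory Submission
  imports Defs "Jordan_Normal_Form.Determinant"
begin

section \<open>Linear systems and dimensions\<close>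

text \<open>The bounds of a Hilbert function from above, by N(j) and by the number of points, hold
  for every set of points, so only lower bounds on ranks remain; these are the open conditions. The
  threshold s comes from n_l >= 1: block l contributes the j_l + 1 monomials in x_{l,0} and x_{l,1},
  so N(j) > j_l. Cutting the entries of a degree at s, when one of them exceeds s, leaves an entry
  s, so N > s and the required rank is s both before and after the cut. Distinctness of the points
  is no extra condition: rank s in degree (s,...,s) forces it.

  Hilbert functions belong to sets of points, while minors need coordinates. The rank of evaluation
  turns out to depend on the points alone, so coordinates may be chosen arbitrarily, point by point.
  The powers p^i make one tuple work in all degrees at once: at the i-th point a monomial takes the
  i-th power of a natural number, and characteristic 0 keeps these numbers distinct in the
  field.\<close>

lemma underdetermined_solution:
  fixes A :: "'t \<Rightarrow> 'c \<Rightarrow> 'a::field"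
  assumes "finite T" "finite C" "card T < card C"
  shows "\<exists>c. (\<forall>t\<in>T. (\<Sum>a\<in>C. c a * A t a) = 0) \<and> (\<exists>a\<in>C. c a \<noteq> 0)"
  using assms
proof (induction T arbitrary: C A rule: finite_induct)
  case empty
  then show ?case by (intro exI[of _ "\<lambda>_. 1"]) (auto simp: card_gt_0_iff)
next
  case (insert t T)
  show ?case
  proof (cases "\<forall>a\<in>C. A t a = 0")
    case True
    then show ?thesis
      using insert.IH[of C A] insert.prems insert.hyps by auto
  next
    case False
    then obtain p where p: "p \<in> C" "A t p \<noteq> 0" by blast
    let ?C = "C - {p}"
    have "card T < card ?C"
      using insert.prems insert.hyps p by (auto simp: card_Diff_singleton)
    then obtain c where c: "\<forall>u\<in>T. (\<Sum>a\<in>?C. c a * (A u a - A u p * A t a / A t p)) = 0"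
        "\<exists>a\<in>?C. c a \<noteq> 0"
      using insert.IH[of ?C "\<lambda>u a. A u a - A u p * A t a / A t p"] insert.prems by auto
    \<comment> \<open>Gaussian elimination: equation \<open>t\<close> is solved for the pivot
      unknown \<open>p\<close>. Substitution turns the other equations into the reduced system
      solved by \<open>c\<close>, and equation \<open>t\<close> itself into 0 = 0.\<close>
    define d where "d = (\<lambda>a. if a = p then - (\<Sum>a\<in>?C. c a * A t a) / A t p else c a)"
    have split: "(\<Sum>a\<in>C. d a * A u a) = (\<Sum>a\<in>?C. c a * (A u a - A u p * A t a / A t p))" for u
    proof -
      have "(\<Sum>a\<in>C. d a * A u a) = d p * A u p + (\<Sum>a\<in>?C. d a * A u a)"
        using p insert.prems by (simp add: sum.remove)
      also have "(\<Sum>a\<in>?C. d a * A u a) = (\<Sum>a\<in>?C. c a * A u a)"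
        by (rule sum.cong) (auto simp: d_def)
      also have "d p * A u p = - (\<Sum>a\<in>?C. c a * (A u p * A t a / A t p))"
        by (simp add: d_def sum_distrib_left sum_distrib_right sum_divide_distrib mult_ac)
      finally show ?thesis
        by (simp add: right_diff_distrib sum_subtractf)
    qed
    have "(\<Sum>a\<in>C. d a * A u a) = 0" if "u \<in> insert t T" for u
      using that c(1) p(2) unfolding split by auto
    moreover have "\<exists>a\<in>C. d a \<noteq> 0"
      using c(2) by (auto simp: d_def)
    ultimately show ?thesis by blast
  qed
qed

text \<open>Linear independence of the \<open>r\<close> columns of a matrix. The rows are indexed by
  an arbitrary set because they will be coordinate vectors of points, or monomials.\<close>

definition trivial_kernel :: "'t set \<Rightarrow> nat \<Rightarrow> ('t \<Rightarrow> nat \<Rightarrow> 'a::field) \<Rightarrow> bool" where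
  "trivial_kernel T r A \<longleftrightarrow> (\<forall>c. (\<forall>t\<in>T. (\<Sum>a<r. c a * A t a) = 0) \<longrightarrow> (\<forall>a<r. c a = 0))"

lemma trivial_kernel_le_card:
  assumes "finite T" "trivial_kernel T r A"
  shows "r \<le> card T"
  using underdetermined_solution[of T "{..<r}" A] assms unfolding trivial_kernel_def
  by (metis card_lessThan finite_lessThan lessThan_iff not_le)

lemma trivial_kernel_square_subsystem:
  assumes "finite T" "trivial_kernel T r A"
  shows "\<exists>S\<subseteq>T. card S = r \<and> trivial_kernel S r A"
  using assms
proof (induction "card T" arbitrary: T rule: less_induct)
  case less
  have "r \<le> card T" by (rule trivial_kernel_le_card) fact+
  show ?case
  proof (cases "card T = r")
    case True
    then show ?thesis using less.prems by blast
  next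
    case False
    then have "r < card T" using \<open>r \<le> card T\<close> by simp
    have "\<exists>w. (\<forall>a\<in>{..<r}. (\<Sum>t\<in>T. w t * A t a) = 0) \<and> (\<exists>t\<in>T. w t \<noteq> 0)"
      by (rule underdetermined_solution) (use \<open>r < card T\<close> less.prems in auto)
    then obtain w t where w: "\<And>a. a < r \<Longrightarrow> (\<Sum>t\<in>T. w t * A t a) = 0" and t: "t \<in> T" "w t \<noteq> 0"
      by auto
    have "trivial_kernel (T - {t}) r A"
      unfolding trivial_kernel_def
    proof (intro allI impI)
      fix c a assume c: "\<forall>u\<in>T - {t}. (\<Sum>a<r. c a * A u a) = 0" and "a < r"
      \<comment> \<open>In the sum of the equations weighted by \<open>w\<close> only row
        \<open>t\<close> survives; exchanging the sums shows that the total is 0.\<close>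
      have "w t * (\<Sum>a<r. c a * A t a) = (\<Sum>u\<in>T. w u * (\<Sum>a<r. c a * A u a))"
        using c less.prems t by (simp add: sum.remove)
      also have "\<dots> = (\<Sum>a<r. c a * (\<Sum>u\<in>T. w u * A u a))"
        by (simp add: sum_distrib_left sum.swap[of _ T] mult_ac)
      also have "\<dots> = 0" using w by simp
      finally have "(\<Sum>a<r. c a * A t a) = 0" using t by simp
      with c have "\<forall>u\<in>T. (\<Sum>a<r. c a * A u a) = 0" by blast
      then show "c a = 0"
        using less.prems(2) \<open>a < r\<close> unfolding trivial_kernel_def by blast
    qed
    then have "\<exists>S\<subseteq>T - {t}. card S = r \<and> trivial_kernel S r A"
      using less.prems t by (intro less.hyps card_Diff1_less) auto
    then show ?thesis by blast
  qed
qed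

text \<open>An injective square system is surjective. The negative of the wanted unit vector is
  adjoined as column \<open>card T\<close>, which gives one unknown more than there are
  equations.\<close>

lemma trivial_kernel_dual_basis:
  assumes "finite T" "trivial_kernel T (card T) A" "t \<in> T"
  shows "\<exists>c. \<forall>u\<in>T. (\<Sum>a<card T. c a * A u a) = (if u = t then 1 else 0)"
proof -
  let ?r = "card T"
  have "\<exists>c. (\<forall>u\<in>T. (\<Sum>a\<in>{..?r}. c a * (if a = ?r then if u = t then - 1 else 0 else A u a)) = 0) \<and>
      (\<exists>a\<in>{..?r}. c a \<noteq> 0)"
    by (rule underdetermined_solution) (use assms in auto)
  then obtain c where
    eq: "\<forall>u\<in>T. (\<Sum>a<Suc ?r. c a * (if a = ?r then if u = t then - 1 else 0 else A u a)) = 0"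
    and nz: "\<exists>a\<le>?r. c a \<noteq> 0"
    unfolding lessThan_Suc_atMost by auto
  have c: "\<forall>u\<in>T. (\<Sum>a<?r. c a * A u a) = (if u = t then c ?r else 0)"
    using eq by (auto split: if_splits)
  \<comment> \<open>A zero coefficient of the extra column would leave a nonzero kernel vector of
    the original system. Hence the solution can be normalised by division.\<close>
  have "c ?r \<noteq> 0"
  proof
    assume "c ?r = 0"
    then have "\<forall>u\<in>T. (\<Sum>a<?r. c a * A u a) = 0" using c by simp
    then have "\<forall>a<?r. c a = 0" using assms(2) unfolding trivial_kernel_def by blast
    then show False using nz \<open>c ?r = 0\<close> by (metis le_neq_implies_less)
  qed
  then show ?thesis
    using c by (intro exI[of _ "\<lambda>a. c a / c ?r"])
      (simp add: sum_divide_distrib[symmetric])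
qed

text \<open>The determinant is kept in Leibniz form so that it can be read as the value of a
  polynomial. The enumeration \<open>\<tau>\<close> need not be injective: a repeated row makes both
  sides false.\<close>

lemma trivial_kernel_iff_det:
  fixes A :: "'t \<Rightarrow> nat \<Rightarrow> 'a::field"
  shows "trivial_kernel (\<tau> ` {..<r}) r A \<longleftrightarrow>
    (\<Sum>p | p permutes {..<r}. of_int (sign p) * (\<Prod>b<r. A (\<tau> b) (p b))) \<noteq> 0"
proof -
  define M where "M = mat r r (\<lambda>(b, a). A (\<tau> b) a)"
  have M: "M \<in> carrier_mat r r" by (simp add: M_def)
  have "det M = (\<Sum>p | p permutes {..<r}. of_int (sign p) * (\<Prod>b<r. A (\<tau> b) (p b)))"
    unfolding det_def'[OF M] atLeast0LessThan
    by (rule sum.cong)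
       (auto simp: M_def permutes_in_image[of _ "{..<r}", simplified] intro!: prod.cong)
  moreover have "det M = 0 \<longleftrightarrow> (\<exists>v. v \<in> carrier_vec r \<and> v \<noteq> 0\<^sub>v r \<and> M *\<^sub>v v = 0\<^sub>v r)"
    by (rule det_0_iff_vec_prod_zero_field[OF M])
  moreover have "\<dots> \<longleftrightarrow> \<not> trivial_kernel (\<tau> ` {..<r}) r A"
  proof
    assume "\<exists>v. v \<in> carrier_vec r \<and> v \<noteq> 0\<^sub>v r \<and> M *\<^sub>v v = 0\<^sub>v r"
    then obtain v where v: "v \<in> carrier_vec r" "v \<noteq> 0\<^sub>v r" "M *\<^sub>v v = 0\<^sub>v r" by blast
    have "(\<Sum>a<r. v $ a * A (\<tau> b) a) = 0" if "b < r" for b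
      using arg_cong[OF v(3), of "\<lambda>w. w $ b"] that v(1)
      by (simp add: M_def scalar_prod_def atLeast0LessThan mult.commute)
    moreover have "\<exists>a<r. v $ a \<noteq> 0" using v(1,2) by auto
    ultimately show "\<not> trivial_kernel (\<tau> ` {..<r}) r A"
      unfolding trivial_kernel_def by blast
  next
    assume "\<not> trivial_kernel (\<tau> ` {..<r}) r A"
    then obtain c a where c: "\<forall>b<r. (\<Sum>a<r. c a * A (\<tau> b) a) = 0" "a < r" "c a \<noteq> 0"
      unfolding trivial_kernel_def by auto
    have "M *\<^sub>v vec r c = 0\<^sub>v r"
      using c(1) by (intro eq_vecI) (auto simp: M_def scalar_prod_def atLeast0LessThan mult.commute)
    moreover have "vec r c \<noteq> 0\<^sub>v r"
      using c(2,3) by (metis index_vec index_zero_vec(1))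
    ultimately show "\<exists>v. v \<in> carrier_vec r \<and> v \<noteq> 0\<^sub>v r \<and> M *\<^sub>v v = 0\<^sub>v r"
      by (intro exI[of _ "vec r c"]) auto
  qed
  ultimately show ?thesis by simp
qed

section \<open>Dimension over a subfield of a ring\<close>

context ring begin

text \<open>\<open>independent\<close> is defined inductively through spans. Coefficient lists of
  exact length match the families \<open>f a\<close> with \<open>a < r\<close> used later.\<close>

lemma independent_iff_combine:
  assumes "subfield K R"
  shows "independent K Us \<longleftrightarrow> set Us \<subseteq> carrier R \<and>
    (\<forall>Ks. set Ks \<subseteq> K \<and> length Ks = length Us \<and> combine Ks Us = \<zero> \<longrightarrow> set Ks \<subseteq> {\<zero>})"
proof (intro iffI conjI allI impI)
  fix Ks assume "independent K Us" "set Ks \<subseteq> K \<and> length Ks = length Us \<and> combine Ks Us = \<zero>"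
  then show "set Ks \<subseteq> {\<zero>}"
    using independent_imp_trivial_combine[OF assms, of Us Ks] by simp
next
  assume *: "set Us \<subseteq> carrier R \<and>
    (\<forall>Ks. set Ks \<subseteq> K \<and> length Ks = length Us \<and> combine Ks Us = \<zero> \<longrightarrow> set Ks \<subseteq> {\<zero>})"
  show "independent K Us"
  proof (rule ccontr)
    assume "dependent K Us"
    then obtain Ks where Ks: "set Ks \<subseteq> K" "combine Ks Us = \<zero>" "\<not> set (take (length Us) Ks) \<subseteq> {\<zero>}"
      using trivial_combine_imp_independent[OF assms] * by metis
    have KR: "set Ks \<subseteq> carrier R" "\<zero> \<in> K"
      using Ks(1) subring_props[OF assms] by auto
    \<comment> \<open>\<open>Ks\<close> may be too short or too long for \<open>Us\<close>; padding
      with zeros or cutting gives the same combination with a list of exact length.\<close>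
    obtain Ks' where Ks': "set (take (length Us) Ks) \<subseteq> set Ks'"
        "set Ks' \<subseteq> set (take (length Us) Ks) \<union> {\<zero>}" "length Ks' = length Us" "combine Ks' Us = \<zero>"
      using combine_normalize[OF KR(1) _ Ks(2)] * by metis
    have "set Ks' \<subseteq> K"
      using Ks'(2) Ks(1) KR(2) set_take_subset[of "length Us" Ks] by blast
    then show False using * Ks' Ks(3) by blast
  qed
qed (auto dest: independent_in_carrier)

lemma independent_drop: "independent K Us \<Longrightarrow> independent K (drop m Us)"
proof (induction Us arbitrary: m)
  case (Cons u Us)
  then show ?case
    using independent_backwards(2)[OF Cons.prems] by (cases m) auto
qed simp

text \<open>A lower bound on a dimension has a witness, and all Hilbert functions are handled
  through such bounds. From left to right, a base is shortened to length \<open>r\<close>.\<close>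

lemma le_dim_iff_independent:
  assumes "subfield K R" "finite_dimension K E"
  shows "r \<le> dim K E \<longleftrightarrow> (\<exists>Us. length Us = r \<and> set Us \<subseteq> E \<and> independent K Us)"
proof
  have d: "dimension (dim K E) K E"
    using finite_dimensionE[OF assms] by (simp add: over_def)
  show "r \<le> dim K E" if "\<exists>Us. length Us = r \<and> set Us \<subseteq> E \<and> independent K Us"
    using that independent_length_le_dimension[OF assms(1) d] by blast
  assume "r \<le> dim K E"
  obtain Vs where Vs: "set Vs \<subseteq> carrier R" "independent K Vs" "length Vs = dim K E" "Span K Vs = E"
    using exists_base[OF assms(1) d] by blast
  have "set Vs \<subseteq> E"
    using Span_base_incl[OF assms(1) Vs(1)] Vs(4) by simp
  then show "\<exists>Us. length Us = r \<and> set Us \<subseteq> E \<and> independent K Us"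
    using \<open>r \<le> dim K E\<close> Vs(3) independent_drop[OF Vs(2)] set_drop_subset[of "dim K E - r" Vs]
    by (intro exI[of _ "drop (dim K E - r) Vs"]) auto
qed

end

lemma (in ring_hom_ring) hom_combine:
  assumes "set Ks \<subseteq> carrier R" "set Us \<subseteq> carrier R"
  shows "S.combine (map h Ks) (map h Us) = h (R.combine Ks Us)"
  using assms by (induction Ks Us rule: R.combine.induct) auto

section \<open>Graded pieces and their monomials\<close>

lemma zero_in_graded_piece [simp]: "0 \<in> graded_piece L n j"
  by (simp add: graded_piece_def carrier_coord_ring)

lemma graded_piece_add:
  "f \<in> graded_piece L n j \<Longrightarrow> g \<in> graded_piece L n j \<Longrightarrow> f + g \<in> graded_piece L n j"
  using Poly_Mapping.keys_add[of f g] by (auto simp: graded_piece_def carrier_add)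

lemma graded_piece_sum:
  "(\<And>a. a \<in> A \<Longrightarrow> f a \<in> graded_piece L n j) \<Longrightarrow> (\<Sum>a\<in>A. f a) \<in> graded_piece L n j"
  by (induction A rule: infinite_finite_induct) (auto intro: graded_piece_add)

lemma graded_piece_mult:
  assumes "f \<in> graded_piece L n i" "g \<in> graded_piece L n j" "\<And>l. l \<in> L \<Longrightarrow> d l = i l + j l"
  shows "f * g \<in> graded_piece L n d"
proof -
  have "(\<Sum>m = 0..n l. Poly_Mapping.lookup \<mu> (l, m)) = d l"
    if "\<mu> \<in> Poly_Mapping.keys (f * g)" "l \<in> L" for \<mu> l
  proof -
    obtain a b where ab: "\<mu> = a + b" "a \<in> Poly_Mapping.keys f" "b \<in> Poly_Mapping.keys g"
      using \<open>\<mu> \<in> Poly_Mapping.keys (f * g)\<close> keys_mult[of f g] by blast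
    then show ?thesis
      using assms \<open>l \<in> L\<close> by (simp add: graded_piece_def lookup_add sum.distrib)
  qed
  then show ?thesis
    using carrier_mult assms(1,2) by (auto simp: graded_piece_def)
qed

lemma constant_in_graded_piece:
  "(\<And>l. l \<in> L \<Longrightarrow> d l = 0) \<Longrightarrow> Poly_Mapping.single 0 c \<in> graded_piece L n d"
  by (simp add: graded_piece_def carrier_coord_ring)

lemma graded_piece_scale:
  "f \<in> graded_piece L n j \<Longrightarrow> Poly_Mapping.single 0 c * f \<in> graded_piece L n j"
  by (rule graded_piece_mult[OF constant_in_graded_piece[of L "\<lambda>_. 0"]]) auto

lemma graded_piece_prod:
  assumes "finite A" "\<And>a. a \<in> A \<Longrightarrow> f a \<in> graded_piece L n (d a)"
    and "\<And>l. l \<in> L \<Longrightarrow> e l = (\<Sum>a\<in>A. d a l)"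
  shows "(\<Prod>a\<in>A. f a) \<in> graded_piece L n e"
  using assms
proof (induction A arbitrary: e rule: finite_induct)
  case empty
  then show ?case using constant_in_graded_piece[of L e 1 n] by simp
next
  case (insert a A)
  have "f a * (\<Prod>a\<in>A. f a) \<in> graded_piece L n e"
  proof (rule graded_piece_mult)
    show "f a \<in> graded_piece L n (d a)" by (rule insert.prems) simp
    show "(\<Prod>a\<in>A. f a) \<in> graded_piece L n (\<lambda>l. \<Sum>a\<in>A. d a l)"
      by (rule insert.IH) (simp_all add: insert.prems)
    show "e l = d a l + (\<Sum>a\<in>A. d a l)" if "l \<in> L" for l
      using insert.prems(2)[OF that] insert.hyps by simp
  qed
  then show ?case
    using insert.hyps by simp
qed

lemma graded_piece_subset_carrier: "graded_piece L n j \<subseteq> carrier (coord_ring L n)"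
  by (auto simp: graded_piece_def)

lemma graded_piece_imp_forms:
  assumes "f \<in> graded_piece L n j"
  shows "f \<in> forms L n"
proof -
  \<comment> \<open>\<open>graded_piece\<close> reads a degree only on \<open>L\<close>, whereas
    \<open>forms\<close> ranges over extensional degrees.\<close>
  have "f \<in> graded_piece L n (restrict j L)"
    using assms by (simp add: graded_piece_def)
  moreover have "restrict j L \<in> multidegrees L"
    by (simp add: multidegrees_def)
  ultimately show ?thesis unfolding forms_def by blast
qed

definition monomials :: "'l set \<Rightarrow> ('l \<Rightarrow> nat) \<Rightarrow> ('l \<Rightarrow> nat) \<Rightarrow> (('l \<times> nat) \<Rightarrow>\<^sub>0 nat) set" where
  "monomials L n j =
     {\<mu>. Poly_Mapping.keys \<mu> \<subseteq> vars L n \<and> (\<forall>l\<in>L. (\<Sum>m = 0..n l. Poly_Mapping.lookup \<mu> (l, m)) = j l)}"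

lemma graded_piece_iff_keys: "f \<in> graded_piece L n j \<longleftrightarrow> Poly_Mapping.keys f \<subseteq> monomials L n j"
  by (auto simp: graded_piece_def carrier_coord_ring monomials_def)

lemma monomial_in_graded_piece: "\<mu> \<in> monomials L n j \<Longrightarrow> Poly_Mapping.single \<mu> c \<in> graded_piece L n j"
  by (auto simp: graded_piece_iff_keys)

lemma finite_vars: "finite L \<Longrightarrow> finite (vars L n)"
  by (simp add: vars_def)

text \<open>Each exponent is at most the degree of its block, so the exponent functions are bounded
  and supported on a finite set.\<close>

lemma finite_monomials:
  assumes "finite L"
  shows "finite (monomials L n j)"
proof (rule finite_imageD)
  let ?b = "\<Sum>l\<in>L. j l"
  have bound: "Poly_Mapping.lookup \<mu> (l, m) \<le> ?b"
    if "\<mu> \<in> monomials L n j" "(l, m) \<in> vars L n" for \<mu> l m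
  proof -
    have "Poly_Mapping.lookup \<mu> (l, m) \<le> (\<Sum>m = 0..n l. Poly_Mapping.lookup \<mu> (l, m))"
      using that by (intro member_le_sum) (auto simp: vars_def)
    also have "\<dots> = j l" using that by (auto simp: monomials_def vars_def)
    also have "\<dots> \<le> ?b" using that assms by (intro member_le_sum) (auto simp: vars_def)
    finally show ?thesis .
  qed
  have "Poly_Mapping.lookup ` monomials L n j \<subseteq>
      {f. \<forall>x. (x \<in> vars L n \<longrightarrow> f x \<in> {..?b}) \<and> (x \<notin> vars L n \<longrightarrow> f x = 0)}"
    using bound by (fastforce simp: monomials_def in_keys_iff)
  then show "finite (Poly_Mapping.lookup ` monomials L n j)"
    by (rule finite_subset) (intro finite_set_of_finite_funs finite_vars assms finite_atMost)
  show "inj_on Poly_Mapping.lookup (monomials L n j)"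
    by (simp add: inj_on_def)
qed

lemma lookup_sum_singles:
  assumes "inj_on \<mu> A" "finite A" "a \<in> A"
  shows "Poly_Mapping.lookup (\<Sum>a\<in>A. Poly_Mapping.single (\<mu> a) (c a)) (\<mu> a) = c a"
proof -
  have "Poly_Mapping.lookup (\<Sum>a\<in>A. Poly_Mapping.single (\<mu> a) (c a)) (\<mu> a) =
      (\<Sum>b\<in>A. if b = a then c b else 0)"
    unfolding lookup_sum lookup_single
    by (rule sum.cong) (use assms in \<open>auto simp: when_def inj_on_def\<close>)
  also have "\<dots> = c a" using assms by simp
  finally show ?thesis .
qed

lemma subfield_constants: "subfield constants (coord_ring L n :: ('l, 'a::field) mpoly ring)"
proof -
  let ?R = "coord_ring L n :: ('l, 'a) mpoly ring"
  interpret cring ?R by (rule cring_coord_ring)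
  have carr: "constants \<subseteq> carrier ?R"
    by (auto simp: constants_def carrier_coord_ring split: if_splits)
  have minus: "\<ominus>\<^bsub>?R\<^esub> x = - x" if "x \<in> carrier ?R" for x
    using that by (intro minus_equality) (simp_all add: carrier_uminus, simp add: coord_ring_def)
  show ?thesis
  proof (rule subfieldI[OF subcringI'])
    show "subring constants ?R"
    proof (rule subringI)
      show "constants \<subseteq> carrier ?R" by (rule carr)
      show "\<ominus>\<^bsub>?R\<^esub> h \<in> constants" if "h \<in> constants" for h
      proof -
        obtain c where "h = Poly_Mapping.single 0 c"
          using \<open>h \<in> constants\<close> by (auto simp: constants_def)
        then have "- h = Poly_Mapping.single 0 (- c)" by (simp add: single_uminus)
        moreover have "\<ominus>\<^bsub>?R\<^esub> h = - h" using that carr by (intro minus) auto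
        ultimately show ?thesis by (simp add: constants_def)
      qed
      have "(1 :: ('l, 'a) mpoly) = Poly_Mapping.single 0 1" by simp
      then have "(1 :: ('l, 'a) mpoly) \<in> constants" unfolding constants_def by (rule range_eqI)
      then show "\<one>\<^bsub>?R\<^esub> \<in> constants" by (simp add: coord_ring_def)
      fix g h :: "('l, 'a) mpoly" assume "g \<in> constants" "h \<in> constants"
      then obtain c d where gh: "g = Poly_Mapping.single 0 c" "h = Poly_Mapping.single 0 d"
        by (auto simp: constants_def)
      then have "g * h = Poly_Mapping.single 0 (c * d)" "g + h = Poly_Mapping.single 0 (c + d)"
        by (simp_all add: mult_single single_add)
      then show "g \<otimes>\<^bsub>?R\<^esub> h \<in> constants" "g \<oplus>\<^bsub>?R\<^esub> h \<in> constants"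
        by (simp_all add: constants_def coord_ring_def)
    qed
    have "\<exists>y\<in>constants. y * x = 1 \<and> x * y = 1" if "x \<in> constants - {0}" for x :: "('l, 'a) mpoly"
    proof -
      obtain c where c: "x = Poly_Mapping.single 0 c"
        using \<open>x \<in> constants - {0}\<close> by (auto simp: constants_def)
      then have "c \<noteq> 0"
        using \<open>x \<in> constants - {0}\<close> by auto
      with c show ?thesis
        by (intro bexI[of _ "Poly_Mapping.single 0 (inverse c)"]) (auto simp: mult_single constants_def)
    qed
    then show "Units (?R\<lparr>carrier := constants\<rparr>) = constants - {\<zero>\<^bsub>?R\<^esub>}"
      by (auto simp: Units_def coord_ring_def)
  qed
qed

lemma combine_coord_ring:
  fixes f :: "'i \<Rightarrow> ('l, 'a::field) mpoly"
  shows "ring.combine (coord_ring L n) (map (\<lambda>a. Poly_Mapping.single 0 (c a)) xs) (map f xs) =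
     (\<Sum>a\<leftarrow>xs. Poly_Mapping.single 0 (c a) * f a)"
proof -
  interpret cring "coord_ring L n :: ('l, 'a) mpoly ring" by (rule cring_coord_ring)
  show ?thesis
    by (induction xs) (simp_all, simp_all add: coord_ring_def)
qed

lemma combine_coord_ring_upt:
  "ring.combine (coord_ring L n) (map (\<lambda>a. Poly_Mapping.single 0 (c a)) [0..<r]) (map f [0..<r]) =
     (\<Sum>a<r. Poly_Mapping.single 0 (c a) * f a)"
  unfolding combine_coord_ring interv_sum_list_conv_sum_set_nat by (simp only: set_upt atLeast0LessThan)

lemma graded_piece_expansion:
  assumes "f \<in> graded_piece L n j" "finite L"
  shows "f = (\<Sum>\<mu>\<in>monomials L n j. Poly_Mapping.single 0 (Poly_Mapping.lookup f \<mu>) * Poly_Mapping.single \<mu> 1)"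
proof -
  have "f = (\<Sum>\<mu>\<in>Poly_Mapping.keys f. Poly_Mapping.single \<mu> (Poly_Mapping.lookup f \<mu>))"
    by (rule poly_mapping_expansion)
  also have "\<dots> = (\<Sum>\<mu>\<in>monomials L n j. Poly_Mapping.single \<mu> (Poly_Mapping.lookup f \<mu>))"
    by (rule sum.mono_neutral_left)
       (use assms finite_monomials in \<open>auto simp: graded_piece_iff_keys in_keys_iff\<close>)
  finally show ?thesis by (simp add: mult_single)
qed

lemma list_in_image_conv_map:
  assumes "set xs \<subseteq> h ` A"
  obtains f where "\<And>a. a < length xs \<Longrightarrow> f a \<in> A" "xs = map (\<lambda>a. h (f a)) [0..<length xs]"
proof -
  have "\<forall>a. \<exists>y. a < length xs \<longrightarrow> y \<in> A \<and> xs ! a = h y"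
    using assms nth_mem by blast
  then obtain f where f: "\<And>a. a < length xs \<Longrightarrow> f a \<in> A \<and> xs ! a = h (f a)"
    by metis
  show ?thesis
    by (rule that[of f]) (use f in \<open>auto intro!: nth_equalityI\<close>)
qed

lemma constants_list:
  assumes "set Ks \<subseteq> h ` constants"
  obtains c where "Ks = map (\<lambda>a. h (Poly_Mapping.single 0 (c a))) [0..<length Ks]"
proof -
  have "set Ks \<subseteq> (\<lambda>c. h (Poly_Mapping.single 0 c)) ` UNIV"
    using assms by (auto simp: constants_def)
  then show thesis
    by (rule list_in_image_conv_map) (rule that)
qed

lemma lookup_constant_mult:
  "Poly_Mapping.lookup (Poly_Mapping.single 0 c * f) \<mu> = c * Poly_Mapping.lookup f \<mu>"
  for f :: "('l, 'a::field) mpoly"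
  by (simp add: mult_map_scale_conv_mult[symmetric] map.rep_eq when_def)

section \<open>Dimensions of homomorphic images of graded pieces\<close>

context
  fixes L :: "'l set" and n :: "'l \<Rightarrow> nat" and S :: "('b, 'c) ring_scheme"
    and h :: "('l, 'a::field) mpoly \<Rightarrow> 'b"
  assumes hom: "ring_hom_ring (coord_ring L n) S h" and nontriv: "\<one>\<^bsub>S\<^esub> \<noteq> \<zero>\<^bsub>S\<^esub>"
begin

interpretation h: ring_hom_ring "coord_ring L n :: ('l, 'a) mpoly ring" S h by (rule hom)

lemma constants_subset_carrier: "constants \<subseteq> carrier (coord_ring L n)"
  using subfieldE(3)[OF subfield_constants] .

text \<open>A ring homomorphism into a nonzero ring is injective on a field, so the constants stay a
  field of scalars.\<close>

lemma hom_image_subfield: "subfield (h ` constants) S" and hom_inj_constants: "inj_on h constants"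
  using h.img_is_subfield[OF subfield_constants nontriv] by auto

lemma combine_hom_image:
  assumes "\<And>a. a < r \<Longrightarrow> f a \<in> carrier (coord_ring L n)"
  shows "ring.combine S (map (\<lambda>a. h (Poly_Mapping.single 0 (c a))) [0..<r]) (map (\<lambda>a. h (f a)) [0..<r]) =
    h (\<Sum>a<r. Poly_Mapping.single 0 (c a) * f a)"
proof -
  let ?Ks = "map (\<lambda>a. Poly_Mapping.single 0 (c a)) [0..<r]" and ?Us = "map f [0..<r]"
  have "set ?Ks \<subseteq> constants" by (auto simp: constants_def)
  then have "h.S.combine (map h ?Ks) (map h ?Us) = h (h.R.combine ?Ks ?Us)"
    using assms constants_subset_carrier by (intro h.hom_combine) auto
  then show ?thesis
    by (simp only: combine_coord_ring_upt map_map comp_def)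
qed

lemma independent_hom_image_iff:
  assumes "\<And>a. a < r \<Longrightarrow> f a \<in> carrier (coord_ring L n)"
  shows "ring.independent S (h ` constants) (map (\<lambda>a. h (f a)) [0..<r]) \<longleftrightarrow>
    (\<forall>c. h (\<Sum>a<r. Poly_Mapping.single 0 (c a) * f a) = \<zero>\<^bsub>S\<^esub> \<longrightarrow> (\<forall>a<r. c a = 0))"
proof -
  let ?Us = "map (\<lambda>a. h (f a)) [0..<r]"
  have zero: "h 0 = \<zero>\<^bsub>S\<^esub>"
    using h.hom_zero by (simp add: coord_ring_def)
  have hc: "h (Poly_Mapping.single 0 c) = \<zero>\<^bsub>S\<^esub> \<longleftrightarrow> c = 0" for c
  proof
    assume "h (Poly_Mapping.single 0 c) = \<zero>\<^bsub>S\<^esub>"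
    then have "h (Poly_Mapping.single 0 c) = h (Poly_Mapping.single 0 0)" using zero by simp
    then have "Poly_Mapping.single 0 c = (Poly_Mapping.single 0 0 :: ('l, 'a) mpoly)"
      by (rule inj_onD[OF hom_inj_constants]) (simp_all only: constants_def rangeI)
    then show "c = 0" by (metis lookup_single_eq)
  qed (simp add: zero)
  have "set ?Us \<subseteq> carrier S" using assms by auto
  then have "h.S.independent (h ` constants) ?Us \<longleftrightarrow>
      (\<forall>Ks. set Ks \<subseteq> h ` constants \<and> length Ks = r \<and> h.S.combine Ks ?Us = \<zero>\<^bsub>S\<^esub> \<longrightarrow> set Ks \<subseteq> {\<zero>\<^bsub>S\<^esub>})"
    by (simp add: h.S.independent_iff_combine[OF hom_image_subfield])
  also have "\<dots> \<longleftrightarrow> (\<forall>c. h (\<Sum>a<r. Poly_Mapping.single 0 (c a) * f a) = \<zero>\<^bsub>S\<^esub> \<longrightarrow> (\<forall>a<r. c a = 0))"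
  proof (intro iffI allI impI)
    fix c a
    let ?Ks = "map (\<lambda>a. h (Poly_Mapping.single 0 (c a))) [0..<r]"
    assume *: "\<forall>Ks. set Ks \<subseteq> h ` constants \<and> length Ks = r \<and> h.S.combine Ks ?Us = \<zero>\<^bsub>S\<^esub> \<longrightarrow> set Ks \<subseteq> {\<zero>\<^bsub>S\<^esub>}"
      and "h (\<Sum>a<r. Poly_Mapping.single 0 (c a) * f a) = \<zero>\<^bsub>S\<^esub>" and "a < r"
    then have "h.S.combine ?Ks ?Us = \<zero>\<^bsub>S\<^esub>"
      using combine_hom_image[OF assms] by simp
    moreover have "set ?Ks \<subseteq> h ` constants" by (auto simp: constants_def)
    ultimately have "set ?Ks \<subseteq> {\<zero>\<^bsub>S\<^esub>}" using * by (metis length_map diff_zero length_upt)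
    moreover have "h (Poly_Mapping.single 0 (c a)) \<in> set ?Ks" using \<open>a < r\<close> by simp
    ultimately show "c a = 0" using hc by blast
  next
    fix Ks
    assume *: "\<forall>c. h (\<Sum>a<r. Poly_Mapping.single 0 (c a) * f a) = \<zero>\<^bsub>S\<^esub> \<longrightarrow> (\<forall>a<r. c a = 0)"
      and Ks: "set Ks \<subseteq> h ` constants \<and> length Ks = r \<and> h.S.combine Ks ?Us = \<zero>\<^bsub>S\<^esub>"
    then obtain c where c: "Ks = map (\<lambda>a. h (Poly_Mapping.single 0 (c a))) [0..<r]"
      using constants_list by metis
    then have "h (\<Sum>a<r. Poly_Mapping.single 0 (c a) * f a) = \<zero>\<^bsub>S\<^esub>"
      using Ks combine_hom_image[OF assms] by simp
    then have "\<forall>a<r. c a = 0" using * by blast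
    then show "set Ks \<subseteq> {\<zero>\<^bsub>S\<^esub>}" using c zero by auto
  qed
  finally show ?thesis .
qed

text \<open>The images of the finitely many monomials of degree \<open>j\<close> span the
  image.\<close>

lemma finite_dimension_hom_image:
  assumes "finite L"
  shows "ring.finite_dimension S (h ` constants) (h ` graded_piece L n j)"
proof -
  obtain ms where ms: "set ms = monomials L n j" "distinct ms"
    using finite_distinct_list[OF finite_monomials[OF assms]] by blast
  let ?r = "length ms" and ?f = "\<lambda>a. Poly_Mapping.single (ms ! a) (1 :: 'a)"
  let ?Us = "map (\<lambda>a. h (?f a)) [0..<?r]"
  have gp: "?f a \<in> graded_piece L n j" if "a < ?r" for a
    using ms nth_mem[OF that] by (intro monomial_in_graded_piece) simp
  then have carr: "?f a \<in> carrier (coord_ring L n)" if "a < ?r" for a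
    using that by (simp add: graded_piece_def)
  then have Us: "set ?Us \<subseteq> carrier S" by auto
  have "h ` graded_piece L n j = h.S.Span (h ` constants) ?Us"
  proof (intro equalityI subsetI)
    fix x assume "x \<in> h ` graded_piece L n j"
    then obtain f where f: "f \<in> graded_piece L n j" "x = h f" by blast
    have "f = (\<Sum>\<mu>\<in>monomials L n j. Poly_Mapping.single 0 (Poly_Mapping.lookup f \<mu>) * Poly_Mapping.single \<mu> 1)"
      using f(1) assms by (rule graded_piece_expansion)
    also have "\<dots> = (\<Sum>a<?r. Poly_Mapping.single 0 (Poly_Mapping.lookup f (ms ! a)) * ?f a)"
      by (rule sum.reindex_bij_betw[symmetric, OF bij_betw_nth]) (use ms in auto)
    finally have "h f = h (\<Sum>a<?r. Poly_Mapping.single 0 (Poly_Mapping.lookup f (ms ! a)) * ?f a)"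
      by (rule arg_cong)
    then have "x = h.S.combine (map (\<lambda>a. h (Poly_Mapping.single 0 (Poly_Mapping.lookup f (ms ! a)))) [0..<?r]) ?Us"
      using combine_hom_image[of ?r ?f, OF carr] f(2) by (simp only:)
    then show "x \<in> h.S.Span (h ` constants) ?Us"
      unfolding h.S.Span_mem_iff_length_version[OF hom_image_subfield Us]
      by (intro exI conjI) (auto simp: constants_def)
  next
    fix x assume "x \<in> h.S.Span (h ` constants) ?Us"
    then obtain Ks where Ks: "set Ks \<subseteq> h ` constants" "length Ks = ?r" "x = h.S.combine Ks ?Us"
      unfolding h.S.Span_mem_iff_length_version[OF hom_image_subfield Us] by auto
    then obtain c where c: "Ks = map (\<lambda>a. h (Poly_Mapping.single 0 (c a))) [0..<?r]"
      using constants_list[OF Ks(1)] by metis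
    then have "x = h (\<Sum>a<?r. Poly_Mapping.single 0 (c a) * ?f a)"
      using Ks combine_hom_image[OF carr] by simp
    then show "x \<in> h ` graded_piece L n j"
      using gp by (auto intro!: graded_piece_sum graded_piece_scale)
  qed
  then show ?thesis
    using h.S.Span_finite_dimension[OF hom_image_subfield Us] by simp
qed

text \<open>Used twice: with the identity for \<open>ring_hilbert\<close>, and with the projection
  modulo the vanishing ideal for \<open>hilbert\<close>. The witnesses are forms that are
  independent modulo the kernel of \<open>h\<close>.\<close>

lemma le_dim_hom_image_iff:
  assumes "finite L"
  shows "r \<le> ring.dim S (h ` constants) (h ` graded_piece L n j) \<longleftrightarrow>
    (\<exists>f. (\<forall>a<r. f a \<in> graded_piece L n j) \<and>
      (\<forall>c. h (\<Sum>a<r. Poly_Mapping.single 0 (c a) * f a) = \<zero>\<^bsub>S\<^esub> \<longrightarrow> (\<forall>a<r. c a = 0)))"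
    (is "_ \<longleftrightarrow> (\<exists>f. ?G f \<and> ?I f)")
proof -
  let ?K = "h ` constants" and ?E = "h ` graded_piece L n j"
  have I: "?I f \<longleftrightarrow> h.S.independent ?K (map (\<lambda>a. h (f a)) [0..<r])" if "?G f" for f
    using that graded_piece_subset_carrier by (subst independent_hom_image_iff) blast+
  have "r \<le> h.S.dim ?K ?E \<longleftrightarrow> (\<exists>Us. length Us = r \<and> set Us \<subseteq> ?E \<and> h.S.independent ?K Us)"
    by (rule h.S.le_dim_iff_independent[OF hom_image_subfield finite_dimension_hom_image[OF assms]])
  also have "\<dots> \<longleftrightarrow> (\<exists>f. ?G f \<and> ?I f)"
  proof
    assume "\<exists>Us. length Us = r \<and> set Us \<subseteq> ?E \<and> h.S.independent ?K Us"
    then obtain Us where Us: "length Us = r" "set Us \<subseteq> ?E" "h.S.independent ?K Us" by blast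
    from Us(2) obtain f where "\<And>a. a < length Us \<Longrightarrow> f a \<in> graded_piece L n j"
        "Us = map (\<lambda>a. h (f a)) [0..<length Us]"
      by (rule list_in_image_conv_map) blast
    then show "\<exists>f. ?G f \<and> ?I f" using Us I[of f] by auto
  next
    assume "\<exists>f. ?G f \<and> ?I f"
    then obtain f where "?G f" "?I f" by blast
    then show "\<exists>Us. length Us = r \<and> set Us \<subseteq> ?E \<and> h.S.independent ?K Us"
      using I[of f] by (intro exI[of _ "map (\<lambda>a. h (f a)) [0..<r]"]) auto
  qed
  finally show ?thesis .
qed

end

lemma le_ring_hilbert_iff:
  fixes L :: "'l set"
  assumes "finite L"
  shows "r \<le> ring_hilbert TYPE('a::field) L n j \<longleftrightarrow>
    (\<exists>f :: nat \<Rightarrow> ('l, 'a) mpoly. (\<forall>a<r. f a \<in> graded_piece L n j) \<and>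
      (\<forall>c. (\<Sum>a<r. Poly_Mapping.single 0 (c a) * f a) = 0 \<longrightarrow> (\<forall>a<r. c a = 0)))"
proof -
  interpret cring "coord_ring L n :: ('l, 'a) mpoly ring" by (rule cring_coord_ring)
  have "ring_hom_ring (coord_ring L n) (coord_ring L n) (id :: ('l, 'a) mpoly \<Rightarrow> _)"
    by (intro ring_hom_ringI2 ring_axioms) (simp add: ring_hom_def)
  from le_dim_hom_image_iff[OF this _ assms, of r j] show ?thesis
    by (simp add: ring_hilbert_def coord_ring_def)
qed

text \<open>The coefficients of independent forms make a matrix with independent columns and one row
  per monomial, which bounds their number. Conversely, the monomials are themselves
  independent.\<close>

lemma ring_hilbert_eq_card:
  fixes L :: "'l set"
  assumes "finite L"
  shows "ring_hilbert TYPE('a::field) L n j = card (monomials L n j)" (is "?N = card ?M")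
proof (rule antisym)
  note fin = finite_monomials[OF assms, of n j]
  obtain f :: "nat \<Rightarrow> ('l, 'a) mpoly" where
    f: "\<forall>a<?N. f a \<in> graded_piece L n j"
    and ind: "\<And>c. (\<Sum>a<?N. Poly_Mapping.single 0 (c a) * f a) = 0 \<Longrightarrow> (\<forall>a<?N. c a = 0)"
    using le_ring_hilbert_iff[OF assms, of ?N n j, where 'a = 'a] by auto
  have "trivial_kernel ?M ?N (\<lambda>\<mu> a. Poly_Mapping.lookup (f a) \<mu>)"
    unfolding trivial_kernel_def
  proof (intro allI impI)
    fix c a assume c: "\<forall>\<mu>\<in>?M. (\<Sum>a<?N. c a * Poly_Mapping.lookup (f a) \<mu>) = 0" and "a < ?N"
    have "(\<Sum>a<?N. Poly_Mapping.single 0 (c a) * f a) = 0"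
    proof (rule poly_mapping_eqI)
      fix \<mu>
      have "(\<Sum>a<?N. c a * Poly_Mapping.lookup (f a) \<mu>) = 0"
      proof (cases "\<mu> \<in> ?M")
        case False
        then have "Poly_Mapping.lookup (f a) \<mu> = 0" if "a < ?N" for a
          using f that by (meson graded_piece_iff_keys in_keys_iff subsetD)
        then show ?thesis by simp
      qed (use c in blast)
      then show "Poly_Mapping.lookup (\<Sum>a<?N. Poly_Mapping.single 0 (c a) * f a) \<mu> = Poly_Mapping.lookup 0 \<mu>"
        by (simp add: lookup_sum lookup_constant_mult)
    qed
    then show "c a = 0" using ind \<open>a < ?N\<close> by blast
  qed
  then show "?N \<le> card ?M"
    by (rule trivial_kernel_le_card[OF fin])
  obtain ms where ms: "set ms = ?M" "distinct ms"
    using finite_distinct_list[OF fin] by blast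
  then have len: "length ms = card ?M" by (metis distinct_card)
  have inj: "inj_on ((!) ms) {..<length ms}"
    using ms by (auto simp: inj_on_def nth_eq_iff_index_eq)
  have "length ms \<le> ?N"
    unfolding le_ring_hilbert_iff[OF assms]
  proof (intro exI conjI allI impI)
    fix a assume "a < length ms"
    then show "Poly_Mapping.single (ms ! a) (1 :: 'a) \<in> graded_piece L n j"
      using ms(1) nth_mem by (intro monomial_in_graded_piece) blast
  next
    fix c :: "nat \<Rightarrow> 'a" and a
    assume c: "(\<Sum>a<length ms. Poly_Mapping.single 0 (c a) * Poly_Mapping.single (ms ! a) 1) = 0" and "a < length ms"
    then show "c a = 0"
      using lookup_sum_singles[OF inj, of a c] by (simp add: mult_single)
  qed
  then show "card ?M \<le> ?N" using len by simp
qed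

section \<open>Hilbert functions as ranks of evaluation\<close>

text \<open>Says that evaluation from the forms of degree \<open>j\<close> to functions on
  \<open>V\<close> has rank at least \<open>r\<close>. \<open>V\<close> consists of coordinate
  vectors, not of points.\<close>

definition eval_rank_ge ::
    "'l set \<Rightarrow> ('l \<Rightarrow> nat) \<Rightarrow> ('l \<Rightarrow> nat) \<Rightarrow> ('l \<Rightarrow> nat \<Rightarrow> 'a::field) set \<Rightarrow> nat \<Rightarrow> bool" where
  "eval_rank_ge L n j V r \<longleftrightarrow>
     (\<exists>f. (\<forall>a<r. f a \<in> graded_piece L n j) \<and> trivial_kernel V r (\<lambda>v a. eval_mpoly v (f a)))"

text \<open>Several vectors of \<open>V\<close> may lie over the same point. This is what happens
  when a tuple repeats a point but chooses different coordinates for it.\<close>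

definition represents :: "'l set \<Rightarrow> ('l \<Rightarrow> nat \<Rightarrow> 'a) set \<Rightarrow> ('l \<Rightarrow> (nat \<Rightarrow> 'a) set) set \<Rightarrow> bool" where
  "represents L V X \<longleftrightarrow>
     (\<forall>v\<in>V. \<exists>P\<in>X. \<forall>l\<in>L. v l \<in> P l) \<and> (\<forall>P\<in>X. \<exists>v\<in>V. \<forall>l\<in>L. v l \<in> P l)"

lemma eval_mpoly_lincomb:
  "eval_mpoly v (\<Sum>a\<in>A. Poly_Mapping.single 0 (c a) * f a) = (\<Sum>a\<in>A. c a * eval_mpoly v (f a))"
  by (simp add: eval_mpoly_sum eval_mpoly_mult eval_mpoly_single)

text \<open>This ideal depends on the chosen coordinates and serves as an upper bound for the
  vanishing ideal.\<close>

lemma ideal_of_coordinates: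
  "ideal {f \<in> carrier (coord_ring L n). \<forall>v\<in>V. eval_mpoly v f = 0}
     (coord_ring L n :: ('l, 'a::field) mpoly ring)" (is "ideal ?J ?R")
proof -
  interpret cring ?R by (rule cring_coord_ring)
  have minus: "\<ominus>\<^bsub>?R\<^esub> x = - x" if "x \<in> carrier ?R" for x
    using that by (intro minus_equality) (simp_all add: carrier_uminus, simp add: coord_ring_def)
  have uminus: "eval_mpoly v (- f) = - eval_mpoly v f" for v and f :: "('l, 'a) mpoly"
    using eval_mpoly_add[of v f "- f"] by (simp add: eq_neg_iff_add_eq_0 add.commute)
  have ops: "x \<oplus>\<^bsub>?R\<^esub> y = x + y" "x \<otimes>\<^bsub>?R\<^esub> y = x * y" "\<zero>\<^bsub>?R\<^esub> = 0" for x y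
    by (simp_all add: coord_ring_def)
  show ?thesis
  proof (rule idealI[OF ring_axioms])
    show "subgroup ?J (add_monoid ?R)"
    proof (rule add.subgroupI)
      have "0 \<in> ?J" using zero_closed by (simp add: ops)
      then show "?J \<noteq> {}" by blast
      show "\<ominus>\<^bsub>?R\<^esub> a \<in> ?J" if "a \<in> ?J" for a
        using that by (simp add: minus carrier_uminus uminus)
      show "a \<oplus>\<^bsub>?R\<^esub> b \<in> ?J" if "a \<in> ?J" "b \<in> ?J" for a b
        using that carrier_add[of a L n b] by (simp add: ops eval_mpoly_add)
    qed auto
    show "x \<otimes>\<^bsub>?R\<^esub> a \<in> ?J" "a \<otimes>\<^bsub>?R\<^esub> x \<in> ?J" if "a \<in> ?J" "x \<in> carrier ?R" for a x
      using that carrier_mult[of a L n x] carrier_mult[of x L n a] by (simp_all add: ops eval_mpoly_mult)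
  qed
qed

text \<open>In degree \<open>j\<close> the vanishing ideal is the kernel of evaluation on
  \<open>V\<close>, so independence modulo the ideal is independence of the columns of values. The
  left side does not mention \<open>V\<close>, hence the rank is independent of the
  coordinates.\<close>

lemma le_hilbert_iff:
  fixes L :: "'l set" and V :: "('l \<Rightarrow> nat \<Rightarrow> 'a::field) set"
  assumes "finite L" "X \<subseteq> multiproj L n" "X \<noteq> {}" "represents L V X"
  shows "r \<le> hilbert L n X j \<longleftrightarrow> eval_rank_ge L n j V r"
proof -
  let ?R = "coord_ring L n :: ('l, 'a) mpoly ring"
  let ?G = "{f \<in> forms L n. \<forall>P\<in>X. vanishes_at L f P}"
  let ?J = "{f \<in> carrier ?R. \<forall>v\<in>V. eval_mpoly v f = 0}"
  define I where "I = vanishing_ideal L n X"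
  interpret R: cring ?R by (rule cring_coord_ring)
  have forms_carr: "forms L n \<subseteq> carrier ?R"
    by (auto simp: forms_def graded_piece_def)
  then have G: "?G \<subseteq> carrier ?R" by blast
  have "?G \<subseteq> ?J"
    using assms(4) forms_carr by (fastforce simp: represents_def vanishes_at_def)
  then have IJ: "I \<subseteq> ?J"
    unfolding I_def vanishing_ideal_def by (rule R.genideal_minimal[OF ideal_of_coordinates])
  have "?G \<subseteq> I"
    unfolding I_def vanishing_ideal_def by (rule R.genideal_self[OF G])
  interpret I: ideal I ?R
    unfolding I_def vanishing_ideal_def by (rule R.genideal_ideal[OF G])
  \<comment> \<open>\<open>I\<close> lies between its generators \<open>?G\<close> and the ideal
    \<open>?J\<close>, and on forms of degree \<open>j\<close> these two agree.\<close>
  have mem_I: "f \<in> I \<longleftrightarrow> (\<forall>v\<in>V. eval_mpoly v f = 0)" if f: "f \<in> graded_piece L n j" for f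
  proof
    assume *: "\<forall>v\<in>V. eval_mpoly v f = 0"
    have form: "f \<in> forms L n" by (rule graded_piece_imp_forms[OF f])
    have "vanishes_at L f P" if "P \<in> X" for P
    proof -
      obtain v where "v \<in> V" "\<And>l. l \<in> L \<Longrightarrow> v l \<in> P l"
        using assms(4) \<open>P \<in> X\<close> unfolding represents_def by metis
      then show ?thesis
        using vanishes_at_iff[OF assms(1) _ form, of P v] assms(2) \<open>P \<in> X\<close> * by blast
    qed
    then show "f \<in> I" using form \<open>?G \<subseteq> I\<close> by blast
  qed (use IJ in blast)
  \<comment> \<open>A single vector of \<open>V\<close> keeps 1 out of \<open>I\<close>, so the
    quotient ring is nonzero.\<close>
  obtain v0 where "v0 \<in> V" using assms(3,4) unfolding represents_def by blast
  have "1 \<notin> I"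
  proof
    assume "1 \<in> I"
    then have "eval_mpoly v0 1 = 0" using IJ \<open>v0 \<in> V\<close> by blast
    then show False by simp
  qed
  have zero: "I +>\<^bsub>?R\<^esub> f = \<zero>\<^bsub>?R Quot I\<^esub> \<longleftrightarrow> f \<in> I" if "f \<in> carrier ?R" for f
    using I.rcos_const_imp_mem[OF that] R.a_rcos_zero[OF I.is_ideal, of f]
    by (auto simp: FactRing_def)
  have "\<one>\<^bsub>?R Quot I\<^esub> \<noteq> \<zero>\<^bsub>?R Quot I\<^esub>"
    using zero[OF R.one_closed] \<open>1 \<notin> I\<close> by (simp add: FactRing_def) (simp add: coord_ring_def)
  from le_dim_hom_image_iff[OF I.rcos_ring_hom_ring this assms(1), of r j]
  have "r \<le> hilbert L n X j \<longleftrightarrow> (\<exists>f. (\<forall>a<r. f a \<in> graded_piece L n j) \<and>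
      (\<forall>c. I +>\<^bsub>?R\<^esub> (\<Sum>a<r. Poly_Mapping.single 0 (c a) * f a) = \<zero>\<^bsub>?R Quot I\<^esub> \<longrightarrow> (\<forall>a<r. c a = 0)))"
    by (simp add: hilbert_def Let_def I_def)
  also have "\<dots> \<longleftrightarrow> eval_rank_ge L n j V r"
    unfolding eval_rank_ge_def trivial_kernel_def
  proof (intro ex_cong1 conj_cong refl all_cong1 imp_cong)
    fix f :: "nat \<Rightarrow> ('l, 'a) mpoly" and c assume "\<forall>a<r. f a \<in> graded_piece L n j"
    then have gp: "(\<Sum>a<r. Poly_Mapping.single 0 (c a) * f a) \<in> graded_piece L n j"
      by (intro graded_piece_sum graded_piece_scale) auto
    then show "I +>\<^bsub>?R\<^esub> (\<Sum>a<r. Poly_Mapping.single 0 (c a) * f a) = \<zero>\<^bsub>?R Quot I\<^esub> \<longleftrightarrow>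
        (\<forall>v\<in>V. (\<Sum>a<r. c a * eval_mpoly v (f a)) = 0)"
      using zero[OF subsetD[OF graded_piece_subset_carrier gp]] mem_I[OF gp]
      by (simp add: eval_mpoly_lincomb)
  qed
  finally show ?thesis .
qed

lemma eval_rank_ge_le_card:
  "finite V \<Longrightarrow> eval_rank_ge L n j V r \<Longrightarrow> r \<le> card V"
  unfolding eval_rank_ge_def using trivial_kernel_le_card by blast

lemma eval_rank_ge_le_ring_hilbert:
  fixes V :: "('l \<Rightarrow> nat \<Rightarrow> 'a::field) set"
  assumes "finite L" "eval_rank_ge L n j V r"
  shows "r \<le> ring_hilbert TYPE('a) L n j"
proof -
  obtain f where f: "\<forall>a<r. f a \<in> graded_piece L n j" "trivial_kernel V r (\<lambda>v a. eval_mpoly v (f a))"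
    using assms(2) by (auto simp: eval_rank_ge_def)
  have "\<forall>a<r. c a = 0" if "(\<Sum>a<r. Poly_Mapping.single 0 (c a) * f a) = 0" for c
  proof -
    have "(\<Sum>a<r. c a * eval_mpoly v (f a)) = 0" for v
      using arg_cong[OF that, of "eval_mpoly v"] by (simp add: eval_mpoly_lincomb)
    then show ?thesis using f(2) unfolding trivial_kernel_def by blast
  qed
  then show ?thesis
    using f(1) by (auto simp: le_ring_hilbert_iff[OF assms(1)])
qed

lemma multiproj_representatives:
  fixes X :: "('l \<Rightarrow> (nat \<Rightarrow> 'a::field) set) set"
  assumes "X \<subseteq> multiproj L n"
  obtains w where "represents L (w ` X) X"
proof -
  have "\<exists>v. \<forall>l\<in>L. v l \<in> P l" if "P \<in> X" for P
  proof -
    have "P \<in> multiproj L n" using assms that by blast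
    then obtain v where "\<forall>l\<in>L. v l \<in> P l" using multiproj_coordinates[of P L n] by metis
    then show ?thesis by blast
  qed
  then obtain w where "\<And>P. P \<in> X \<Longrightarrow> \<forall>l\<in>L. w P l \<in> P l" by metis
  then show thesis
    by (intro that[of w]) (auto simp: represents_def)
qed

text \<open>\<open>V\<close> may be larger than \<open>X\<close>. Since the rank depends only on
  \<open>X\<close>, \<open>V\<close> can be exchanged for one vector per point.\<close>

lemma eval_rank_ge_le_card_points:
  assumes "finite L" "X \<subseteq> multiproj L n" "X \<noteq> {}" "finite X" "represents L V X" "eval_rank_ge L n j V r"
  shows "r \<le> card X"
proof -
  obtain w where w: "represents L (w ` X) X"
    using multiproj_representatives[OF assms(2)] by blast
  then have "eval_rank_ge L n j (w ` X) r"
    using le_hilbert_iff[OF assms(1-3)] assms(5,6) by blast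
  then have "r \<le> card (w ` X)"
    using assms(4) by (intro eval_rank_ge_le_card) auto
  also have "\<dots> \<le> card X" by (rule card_image_le[OF assms(4)])
  finally show ?thesis .
qed

text \<open>The inequality from above always holds; the equality therefore reduces to a lower bound
  on the rank.\<close>

lemma hilbert_eq_iff:
  fixes L :: "'l set" and V :: "('l \<Rightarrow> nat \<Rightarrow> 'a::field) set"
  assumes "finite L" "X \<subseteq> multiproj L n" "X \<noteq> {}" "finite X" "represents L V X"
  shows "hilbert L n X j = min (ring_hilbert TYPE('a) L n j) (card X) \<longleftrightarrow>
    eval_rank_ge L n j V (min (ring_hilbert TYPE('a) L n j) (card X))"
proof -
  let ?N = "ring_hilbert TYPE('a) L n j"
  note le = le_hilbert_iff[OF assms(1-3,5), where j = j]
  have "eval_rank_ge L n j V (hilbert L n X j)" using le by blast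
  then have "hilbert L n X j \<le> min ?N (card X)"
    using eval_rank_ge_le_card_points[OF assms] eval_rank_ge_le_ring_hilbert[OF assms(1)] by simp
  then show ?thesis by (simp add: le[symmetric] eq_iff)
qed

section \<open>Reduction to finitely many degrees\<close>

lemma eval_mpoly_prod: "eval_mpoly v (\<Prod>i\<in>A. f i) = (\<Prod>i\<in>A. eval_mpoly v (f i))"
  by (induction A rule: infinite_finite_induct) (simp_all add: eval_mpoly_mult)

lemma single_monomial_in_graded_piece:
  assumes "l \<in> L" "m \<le> n l"
  shows "Poly_Mapping.single (Poly_Mapping.single (l, m) k) c \<in> graded_piece L n (\<lambda>l'. if l' = l then k else 0)"
  using assms
  by (intro monomial_in_graded_piece)
     (auto simp: monomials_def vars_def lookup_single when_def)

text \<open>In each block a coordinate that is nonzero at \<open>v\<close> is raised to the required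
  degree.\<close>

lemma nonvanishing_form:
  fixes v :: "'l \<Rightarrow> nat \<Rightarrow> 'a::field"
  assumes "finite L" "\<And>l. l \<in> L \<Longrightarrow> \<exists>m\<le>n l. v l m \<noteq> 0"
  shows "\<exists>f\<in>graded_piece L n j. eval_mpoly v f \<noteq> 0"
proof -
  obtain m where m: "\<And>l. l \<in> L \<Longrightarrow> m l \<le> n l \<and> v l (m l) \<noteq> 0"
    using assms(2) by metis
  let ?f = "\<lambda>l. Poly_Mapping.single (Poly_Mapping.single (l, m l) (j l)) (1 :: 'a)"
  have "(\<Prod>l\<in>L. ?f l) \<in> graded_piece L n j"
    by (rule graded_piece_prod[where d = "\<lambda>l l'. if l' = l then j l else 0"])
       (use assms(1) m in \<open>auto intro!: single_monomial_in_graded_piece\<close>)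
  moreover have "eval_mpoly v (\<Prod>l\<in>L. ?f l) \<noteq> 0"
    using assms(1) m by (auto simp: eval_mpoly_prod eval_mpoly_single)
  ultimately show ?thesis by blast
qed

text \<open>Full rank gives for each vector a form that is 1 there and 0 at the others. Multiplied
  by a form of the missing degree, it still separates the vector, and the new matrix of values is
  diagonal.\<close>

lemma eval_rank_ge_mono_degree:
  fixes V :: "('l \<Rightarrow> nat \<Rightarrow> 'a::field) set"
  assumes "finite L" "finite V" "eval_rank_ge L n j V (card V)"
    and le: "\<And>l. l \<in> L \<Longrightarrow> j l \<le> j' l"
    and nz: "\<And>v l. v \<in> V \<Longrightarrow> l \<in> L \<Longrightarrow> \<exists>m\<le>n l. v l m \<noteq> 0"
  shows "eval_rank_ge L n j' V (card V)"
proof -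
  let ?s = "card V"
  obtain f where f: "\<forall>a<?s. f a \<in> graded_piece L n j" "trivial_kernel V ?s (\<lambda>v a. eval_mpoly v (f a))"
    using assms(3) by (auto simp: eval_rank_ge_def)
  have "\<exists>g\<in>graded_piece L n j'. eval_mpoly t g \<noteq> 0 \<and> (\<forall>u\<in>V - {t}. eval_mpoly u g = 0)" if t: "t \<in> V" for t
  proof -
    obtain c where c: "\<forall>u\<in>V. (\<Sum>a<?s. c a * eval_mpoly u (f a)) = (if u = t then 1 else 0)"
      using trivial_kernel_dual_basis[OF assms(2) f(2) t] by blast
    define g where "g = (\<Sum>a<?s. Poly_Mapping.single 0 (c a) * f a)"
    have g: "g \<in> graded_piece L n j"
      unfolding g_def using f(1) by (intro graded_piece_sum graded_piece_scale) auto
    \<comment> \<open>Only the value of \<open>h\<close> at \<open>t\<close> matters, because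
      \<open>g\<close> already vanishes on the rest of \<open>V\<close>.\<close>
    obtain h where h: "h \<in> graded_piece L n (\<lambda>l. j' l - j l)" "eval_mpoly t h \<noteq> 0"
      using nonvanishing_form[of L n t "\<lambda>l. j' l - j l"] assms(1) nz[of t] t by blast
    have "g * h \<in> graded_piece L n j'"
      using le by (intro graded_piece_mult[OF g h(1)]) auto
    moreover have "eval_mpoly u g = (if u = t then 1 else 0)" if "u \<in> V" for u
      using c that by (simp add: g_def eval_mpoly_lincomb)
    ultimately show ?thesis
      using h(2) t by (intro bexI[of _ "g * h"]) (auto simp: eval_mpoly_mult)
  qed
  then obtain g where g: "\<And>t. t \<in> V \<Longrightarrow> g t \<in> graded_piece L n j'"
      "\<And>t. t \<in> V \<Longrightarrow> eval_mpoly t (g t) \<noteq> 0" "\<And>t u. t \<in> V \<Longrightarrow> u \<in> V \<Longrightarrow> u \<noteq> t \<Longrightarrow> eval_mpoly u (g t) = 0"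
    by (metis DiffI singletonD)
  obtain e where e: "bij_betw e {..<?s} V"
    using ex_bij_betw_nat_finite[OF assms(2)] by (auto simp: atLeast0LessThan)
  show ?thesis
    unfolding eval_rank_ge_def trivial_kernel_def
  proof (intro exI conjI allI impI)
    show "g (e a) \<in> graded_piece L n j'" if "a < ?s" for a
      using e that by (intro g(1)) (auto simp: bij_betw_def)
    fix c a assume c: "\<forall>v\<in>V. (\<Sum>a<?s. c a * eval_mpoly v (g (e a))) = 0" and a: "a < ?s"
    have ea: "e a \<in> V" using e a by (auto simp: bij_betw_def)
    have "(\<Sum>b<?s. c b * eval_mpoly (e a) (g (e b))) = (\<Sum>b<?s. if b = a then c a * eval_mpoly (e a) (g (e a)) else 0)"
    proof (rule sum.cong[OF refl])
      fix b assume "b \<in> {..<?s}"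
      then have "e b \<in> V" "b \<noteq> a \<Longrightarrow> e a \<noteq> e b"
        using e a by (auto simp: bij_betw_def inj_on_def)
      then show "c b * eval_mpoly (e a) (g (e b)) = (if b = a then c a * eval_mpoly (e a) (g (e a)) else 0)"
        using g(3)[OF _ ea] by simp
    qed
    also have "\<dots> = c a * eval_mpoly (e a) (g (e a))" using a by simp
    finally show "c a = 0" using c ea g(2)[OF ea] by auto
  qed
qed

text \<open>This is where positive dimension of the factors enters, and it is the origin of the
  degree bound \<open>s\<close>.\<close>

lemma degree_less_ring_hilbert:
  fixes j :: "'l \<Rightarrow> nat"
  assumes "finite L" "l \<in> L" "n l \<ge> 1"
  shows "j l < ring_hilbert TYPE('a::field) L n j"
proof -
  \<comment> \<open>Exponents of x_{l,0}^i x_{l,1}^(j_l - i), times the power x_{l',0}^(j_l') for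
    every other block l'.\<close>
  define e where "e = (\<lambda>i (l', m :: nat). if l' \<in> L \<and> m = 0 then if l' = l then i else j l'
      else if l' = l \<and> m = 1 then j l - i else (0 :: nat))"
  have e_outside: "e i x = 0" if "x \<notin> vars L n" for i x
    using that assms by (auto simp: e_def vars_def split: prod.splits)
  have "{x. e i x \<noteq> 0} \<subseteq> vars L n" for i
    using e_outside[of _ i] by (auto intro: ccontr)
  then have fin: "finite {x. e i x \<noteq> 0}" for i
    by (rule finite_subset) (rule finite_vars[OF assms(1)])
  define \<mu> where "\<mu> = (\<lambda>i. Abs_poly_mapping (e i))"
  have lookup_\<mu>: "Poly_Mapping.lookup (\<mu> i) = e i" for i
    unfolding \<mu>_def using fin by (simp add: Abs_poly_mapping_inverse)
  have "\<mu> i \<in> monomials L n j" if "i \<le> j l" for i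
  proof -
    have "(\<Sum>m = 0..n l'. e i (l', m)) = j l'" if l': "l' \<in> L" for l'
    proof (cases "l' = l")
      case True
      have "(\<Sum>m = 0..n l. e i (l, m)) = (\<Sum>m = 0..n l. (if m = 0 then i else 0) + (if m = 1 then j l - i else 0))"
        by (rule sum.cong) (use assms in \<open>auto simp: e_def\<close>)
      also have "\<dots> = i + (j l - i)" using assms(3) by (simp add: sum.distrib)
      finally show ?thesis using True \<open>i \<le> j l\<close> by simp
    next
      case False
      have "(\<Sum>m = 0..n l'. e i (l', m)) = (\<Sum>m = 0..n l'. if m = 0 then j l' else 0)"
        by (rule sum.cong) (use l' False in \<open>auto simp: e_def\<close>)
      then show ?thesis by simp
    qed
    moreover have "Poly_Mapping.keys (\<mu> i) \<subseteq> vars L n"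
      using e_outside[of _ i] by (auto simp: in_keys_iff lookup_\<mu> intro: ccontr)
    ultimately show ?thesis by (simp add: monomials_def lookup_\<mu>)
  qed
  then have sub: "\<mu> ` {..j l} \<subseteq> monomials L n j" by auto
  have "inj_on \<mu> {..j l}"
  proof (rule inj_onI)
    fix i i' assume "\<mu> i = \<mu> i'"
    then have "e i (l, 0) = e i' (l, 0)" by (metis lookup_\<mu>)
    then show "i = i'" using assms(2) by (simp add: e_def)
  qed
  then have "Suc (j l) = card (\<mu> ` {..j l})" by (simp add: card_image)
  also have "\<dots> \<le> card (monomials L n j)"
    by (rule card_mono[OF finite_monomials[OF assms(1)] sub])
  finally show ?thesis by (simp add: ring_hilbert_eq_card[OF assms(1)])
qed

lemma proj_space_coordinate:
  assumes "p \<in> proj_space d" "v \<in> p"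
  shows "\<exists>m\<le>d. v m \<noteq> 0"
proof -
  have "v \<in> nonzero_vecs d"
    using assms by (auto simp: proj_space_def proportional_def elim!: quotientE)
  then obtain m where "v m \<noteq> 0" "\<forall>m>d. v m = 0" by (auto simp: nonzero_vecs_def)
  then show ?thesis by (meson leI)
qed

text \<open>Replaces injectivity and infinitely many degrees by finitely many rank conditions, for
  any choice of coordinates.\<close>

lemma generic_tuple_iff:
  fixes P :: "nat \<Rightarrow> 'l \<Rightarrow> (nat \<Rightarrow> 'a::field) set"
  assumes "finite L" "L \<noteq> {}" "\<And>l. l \<in> L \<Longrightarrow> n l \<ge> 1" "s \<ge> 1"
    and P: "P \<in> point_tuples s L n"
    and v: "\<And>i l. i \<in> {1..s} \<Longrightarrow> l \<in> L \<Longrightarrow> v i l \<in> P i l"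
  shows "generic_tuple s L n P \<longleftrightarrow>
    (\<forall>j\<in>L \<rightarrow>\<^sub>E {..s}. eval_rank_ge L n j (v ` {1..s}) (min (ring_hilbert TYPE('a) L n j) s))"
proof -
  let ?X = "P ` {1..s}" and ?V = "v ` {1..s}"
  let ?N = "ring_hilbert TYPE('a) L n"
  have X: "?X \<subseteq> multiproj L n" "?X \<noteq> {}" "finite ?X"
    using P assms(4) by (auto simp: point_tuples_def)
  have rep: "represents L ?V ?X"
    unfolding represents_def using v by blast
  have nz: "\<exists>m\<le>n l. w l m \<noteq> 0" if w: "w \<in> ?V" "l \<in> L" for w l
  proof -
    obtain i where i: "i \<in> {1..s}" "w = v i" using w by auto
    then have "P i l \<in> proj_space (n l)"
      using P w(2) by (auto simp: point_tuples_def multiproj_def PiE_iff)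
    then show ?thesis using proj_space_coordinate v i w(2) by blast
  qed
  have N: "j l < ?N j" if "l \<in> L" for l j
    using degree_less_ring_hilbert[of L l n j] assms(1,3) that by blast
  have cardV: "card ?V \<le> s" using card_image_le[of "{1..s}" v] by simp
  have generic: "generic_position L n ?X \<longleftrightarrow>
      (\<forall>j\<in>multidegrees L. eval_rank_ge L n j ?V (min (?N j) s))" if "inj_on P {1..s}"
  proof -
    have "card ?X = s" using card_image[OF that] by simp
    then show ?thesis
      unfolding generic_position_def hilbert_eq_iff[OF assms(1) X rep] using X by simp
  qed
  show ?thesis
  proof
    assume "generic_tuple s L n P"
    then show "\<forall>j\<in>L \<rightarrow>\<^sub>E {..s}. eval_rank_ge L n j ?V (min (?N j) s)"
      using generic by (auto simp: generic_tuple_def multidegrees_def PiE_iff)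
  next
    assume box: "\<forall>j\<in>L \<rightarrow>\<^sub>E {..s}. eval_rank_ge L n j ?V (min (?N j) s)"
    \<comment> \<open>In the degree with all entries \<open>s\<close> the required rank is
      \<open>s\<close>, and fewer than \<open>s\<close> points cannot provide it.\<close>
    have "s \<le> card ?X"
    proof -
      define j where "j = (\<lambda>l\<in>L. s)"
      obtain l where "l \<in> L" using assms(2) by blast
      then have "s < ?N j"
        using N[of l j] by (simp add: j_def)
      moreover have "j \<in> L \<rightarrow>\<^sub>E {..s}" by (auto simp: j_def)
      ultimately have "eval_rank_ge L n j ?V s" using box by fastforce
      then show ?thesis by (rule eval_rank_ge_le_card_points[OF assms(1) X rep])
    qed
    then have inj: "inj_on P {1..s}"
      using card_image_le[of "{1..s}" P] by (intro eq_card_imp_inj_on) auto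
    have "eval_rank_ge L n j ?V (min (?N j) s)" if j: "j \<in> multidegrees L" for j
    proof (cases "\<forall>l\<in>L. j l \<le> s")
      case True
      then have "j \<in> L \<rightarrow>\<^sub>E {..s}" using j by (auto simp: multidegrees_def PiE_iff)
      then show ?thesis using box by blast
    next
      case False
      then obtain l where l: "l \<in> L" "s < j l" by auto
      \<comment> \<open>Block \<open>l\<close> keeps degree exactly \<open>s\<close>, so the
        truncated degree still demands full rank \<open>s\<close>.\<close>
      define j' where "j' = (\<lambda>l\<in>L. min (j l) s)"
      have "s < ?N j'"
        using N[OF l(1), of j'] l by (simp add: j'_def)
      moreover have "j' \<in> L \<rightarrow>\<^sub>E {..s}" by (auto simp: j'_def)
      ultimately have r: "eval_rank_ge L n j' ?V s" using box by fastforce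
      \<comment> \<open>Rank \<open>s\<close> also makes the coordinate vectors distinct, as the
        passage to a larger degree needs rank \<open>card ?V\<close>.\<close>
      then have "card ?V = s"
        using cardV eval_rank_ge_le_card[OF _ r] by simp
      then have "eval_rank_ge L n j ?V s"
        using eval_rank_ge_mono_degree[OF assms(1), of ?V n j' j] r nz by (auto simp: j'_def)
      moreover have "s < ?N j"
        using N[OF l(1), of j] l by simp
      ultimately show ?thesis by simp
    qed
    then show "generic_tuple s L n P"
      using P inj generic[OF inj] by (simp add: generic_tuple_def)
  qed
qed

section \<open>Openness\<close>

text \<open>The substitution of x_{(i,l),m} for x_{l,m}, which turns a monomial in the coordinates
  of one point into one in those of the \<open>i\<close>-th point.\<close>

definition block_monomial :: "nat \<Rightarrow> (('l \<times> nat) \<Rightarrow>\<^sub>0 nat) \<Rightarrow> (((nat \<times> 'l) \<times> nat) \<Rightarrow>\<^sub>0 nat)" where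
  "block_monomial i \<mu> =
     (\<Sum>x\<in>Poly_Mapping.keys \<mu>. Poly_Mapping.single ((i, fst x), snd x) (Poly_Mapping.lookup \<mu> x))"

definition block_poly :: "nat \<Rightarrow> ('l, 'a::field) mpoly \<Rightarrow> (nat \<times> 'l, 'a) mpoly" where
  "block_poly i f =
     (\<Sum>\<mu>\<in>Poly_Mapping.keys f. Poly_Mapping.single (block_monomial i \<mu>) (Poly_Mapping.lookup f \<mu>))"

lemma lookup_block_monomial:
  "Poly_Mapping.lookup (block_monomial i \<mu>) ((a, l), m) = (if a = i then Poly_Mapping.lookup \<mu> (l, m) else 0)"
proof (cases "a = i")
  case True
  have "Poly_Mapping.lookup (block_monomial i \<mu>) ((a, l), m) =
      (\<Sum>x\<in>Poly_Mapping.keys \<mu>. if x = (l, m) then Poly_Mapping.lookup \<mu> (l, m) else 0)"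
    unfolding block_monomial_def lookup_sum lookup_single
    by (rule sum.cong) (use True in \<open>auto simp: when_def\<close>)
  then show ?thesis using True by (simp add: in_keys_iff)
next
  case False
  then show ?thesis
    by (simp add: block_monomial_def lookup_sum lookup_single when_def)
qed

lemma keys_block_monomial:
  "Poly_Mapping.keys (block_monomial i \<mu>) = (\<lambda>x. ((i, fst x), snd x)) ` Poly_Mapping.keys \<mu>"
  by (force simp: in_keys_iff lookup_block_monomial split: if_splits)

lemma block_monomial_in_monomials:
  assumes "\<mu> \<in> monomials L n j" "i \<in> {1..s}"
  shows "block_monomial i \<mu> \<in> monomials ({1..s} \<times> L) (\<lambda>(i, l). n l) (\<lambda>(a, l). if a = i then j l else 0)"
  using assms
  by (auto simp: monomials_def keys_block_monomial lookup_block_monomial vars_def)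

lemma block_poly_in_graded_piece:
  assumes "f \<in> graded_piece L n j" "i \<in> {1..s}"
  shows "block_poly i f \<in> graded_piece ({1..s} \<times> L) (\<lambda>(i, l). n l) (\<lambda>(a, l). if a = i then j l else 0)"
  unfolding block_poly_def
  using assms(1)
  by (intro graded_piece_sum monomial_in_graded_piece block_monomial_in_monomials assms(2))
     (auto simp: graded_piece_iff_keys)

lemma eval_block_poly: "eval_mpoly w (block_poly i f) = eval_mpoly (\<lambda>l. w (i, l)) f"
proof -
  have "eval_mpoly w (Poly_Mapping.single (block_monomial i \<mu>) c) =
      c * (\<Prod>(l, m)\<in>Poly_Mapping.keys \<mu>. w (i, l) m ^ Poly_Mapping.lookup \<mu> (l, m))" for \<mu> c
  proof -
    have "inj_on (\<lambda>x. ((i, fst x), snd x)) (Poly_Mapping.keys \<mu>)" by (auto simp: inj_on_def)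
    then show ?thesis
      by (simp add: eval_mpoly_single keys_block_monomial prod.reindex lookup_block_monomial case_prod_beta)
  qed
  then show ?thesis
    unfolding block_poly_def eval_mpoly_sum by (simp add: eval_mpoly_def)
qed

text \<open>The Leibniz expansion of a minor of the evaluation matrix, as a polynomial in the
  coordinates of all \<open>s\<close> points: row \<open>b\<close> belongs to the point
  \<open>\<tau> b\<close>, the columns to the forms \<open>f\<close>.\<close>

definition eval_minor :: "nat \<Rightarrow> (nat \<Rightarrow> nat) \<Rightarrow> (nat \<Rightarrow> ('l, 'a::field) mpoly) \<Rightarrow> (nat \<times> 'l, 'a) mpoly" where
  "eval_minor r \<tau> f =
     (\<Sum>p | p permutes {..<r}. Poly_Mapping.single 0 (of_int (sign p)) * (\<Prod>b<r. block_poly (\<tau> b) (f (p b))))"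

text \<open>All columns have degree \<open>j\<close>, so permuting them does not change the
  multidegree: each row \<open>b\<close> adds \<open>j\<close> to the block of the point
  \<open>\<tau> b\<close>.\<close>

lemma eval_minor_in_forms:
  assumes "\<forall>a<r. f a \<in> graded_piece L n j" "\<tau> ` {..<r} \<subseteq> {1..s}"
  shows "eval_minor r \<tau> f \<in> forms ({1..s} \<times> L) (\<lambda>(i, l). n l)"
proof -
  let ?d = "\<lambda>x. \<Sum>b<r. (case x of (a, l) \<Rightarrow> if a = \<tau> b then j l else 0)"
  have "(\<Prod>b<r. block_poly (\<tau> b) (f (p b))) \<in> graded_piece ({1..s} \<times> L) (\<lambda>(i, l). n l) ?d"
    if "p permutes {..<r}" for p
  proof (rule graded_piece_prod)
    fix b assume "b \<in> {..<r}"
    moreover from this have "p b < r"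
      using permutes_in_image[OF \<open>p permutes {..<r}\<close>, of b] by simp
    ultimately show "block_poly (\<tau> b) (f (p b)) \<in> graded_piece ({1..s} \<times> L) (\<lambda>(i, l). n l)
        (\<lambda>(a, l). if a = \<tau> b then j l else 0)"
      using assms by (intro block_poly_in_graded_piece) auto
  qed auto
  then have "eval_minor r \<tau> f \<in> graded_piece ({1..s} \<times> L) (\<lambda>(i, l). n l) ?d"
    unfolding eval_minor_def by (intro graded_piece_sum graded_piece_scale) simp
  then show ?thesis by (rule graded_piece_imp_forms)
qed

lemma eval_eval_minor:
  "eval_mpoly w (eval_minor r \<tau> f) \<noteq> 0 \<longleftrightarrow>
     trivial_kernel ((\<lambda>b l. w (\<tau> b, l)) ` {..<r}) r (\<lambda>v a. eval_mpoly v (f a))"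
  unfolding trivial_kernel_iff_det eval_minor_def eval_mpoly_lincomb eval_mpoly_prod eval_block_poly ..

lemma trivial_kernel_superset: "trivial_kernel S r A \<Longrightarrow> S \<subseteq> T \<Longrightarrow> trivial_kernel T r A"
  unfolding trivial_kernel_def by blast

text \<open>The forms remain existentially quantified, so a minor has to select rows only;
  \<open>trivial_kernel_square_subsystem\<close> does this.\<close>

lemma eval_rank_ge_iff_minor:
  "eval_rank_ge L n j ((\<lambda>i l. w (i, l)) ` {1..s}) r \<longleftrightarrow>
    (\<exists>f \<tau>. (\<forall>a<r. f a \<in> graded_piece L n j) \<and> \<tau> ` {..<r} \<subseteq> {1..s} \<and> eval_mpoly w (eval_minor r \<tau> f) \<noteq> 0)"
proof
  let ?u = "\<lambda>i l. w (i, l)"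
  assume "eval_rank_ge L n j (?u ` {1..s}) r"
  then obtain f where f: "\<forall>a<r. f a \<in> graded_piece L n j"
      "trivial_kernel (?u ` {1..s}) r (\<lambda>v a. eval_mpoly v (f a))"
    by (auto simp: eval_rank_ge_def)
  obtain S where S: "S \<subseteq> ?u ` {1..s}" "card S = r" "trivial_kernel S r (\<lambda>v a. eval_mpoly v (f a))"
    using trivial_kernel_square_subsystem[OF _ f(2)] by auto
  have "finite S" using S(1) by (rule finite_subset) simp
  then obtain e where e: "bij_betw e {..<r} S"
    using ex_bij_betw_nat_finite S(2) by (metis atLeast0LessThan)
  \<comment> \<open>Rows were selected as vectors, and different points may share one;
    \<open>\<tau>\<close> picks an index for each.\<close>
  have "\<forall>b\<in>{..<r}. \<exists>i\<in>{1..s}. e b = ?u i"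
    using e S(1) by (force simp: bij_betw_def)
  then obtain \<tau> where \<tau>: "\<And>b. b < r \<Longrightarrow> \<tau> b \<in> {1..s} \<and> e b = ?u (\<tau> b)"
    by (metis lessThan_iff)
  have "(\<lambda>b. ?u (\<tau> b)) ` {..<r} = e ` {..<r}"
    by (rule image_cong) (use \<tau> in auto)
  also have "\<dots> = S" using e by (simp add: bij_betw_def)
  finally have "eval_mpoly w (eval_minor r \<tau> f) \<noteq> 0"
    using S(3) by (simp add: eval_eval_minor)
  then show "\<exists>f \<tau>. (\<forall>a<r. f a \<in> graded_piece L n j) \<and> \<tau> ` {..<r} \<subseteq> {1..s} \<and> eval_mpoly w (eval_minor r \<tau> f) \<noteq> 0"
    using f(1) \<tau> by blast
next
  assume "\<exists>f \<tau>. (\<forall>a<r. f a \<in> graded_piece L n j) \<and> \<tau> ` {..<r} \<subseteq> {1..s} \<and> eval_mpoly w (eval_minor r \<tau> f) \<noteq> 0"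
  then obtain f \<tau> where f: "\<forall>a<r. f a \<in> graded_piece L n j" and \<tau>: "\<tau> ` {..<r} \<subseteq> {1..s}"
      and nz: "eval_mpoly w (eval_minor r \<tau> f) \<noteq> 0"
    by blast
  have "trivial_kernel ((\<lambda>i l. w (i, l)) ` {1..s}) r (\<lambda>v a. eval_mpoly v (f a))"
    using nz unfolding eval_eval_minor by (rule trivial_kernel_superset) (use \<tau> in auto)
  then show "eval_rank_ge L n j ((\<lambda>i l. w (i, l)) ` {1..s}) r"
    using f by (auto simp: eval_rank_ge_def)
qed

text \<open>The choice \<open>v\<close> of coordinates may vary with \<open>P\<close> without any
  regularity: whether a minor vanishes does not depend on it, because minors are
  multihomogeneous.\<close>

lemma openin_eval_rank_ge:
  fixes v :: "(nat \<Rightarrow> 'l \<Rightarrow> (nat \<Rightarrow> 'a::field) set) \<Rightarrow> nat \<Rightarrow> 'l \<Rightarrow> nat \<Rightarrow> 'a"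
  assumes "finite L"
    and v: "\<And>P i l. P \<in> point_tuples s L n \<Longrightarrow> i \<in> {1..s} \<Longrightarrow> l \<in> L \<Longrightarrow> v P i l \<in> P i l"
  shows "openin (zariski_power s L n) {P \<in> point_tuples s L n. eval_rank_ge L n j (v P ` {1..s}) r}"
proof -
  let ?L = "{1..s} \<times> L" and ?n = "\<lambda>(i :: nat, l). n l"
  let ?F = "{eval_minor r \<tau> f | f \<tau>. (\<forall>a<r. f a \<in> graded_piece L n j) \<and> \<tau> ` {..<r} \<subseteq> {1..s}} :: (nat \<times> 'l, 'a) mpoly set"
  let ?U = "multiproj ?L ?n - zero_locus ?L ?n ?F"
  have F: "?F \<subseteq> forms ?L ?n" using eval_minor_in_forms by blast
  have finL: "finite ?L" using assms(1) by simp
  have U: "openin (zariski ?L ?n) ?U"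
    unfolding openin_zariski[OF finL] using F by blast
  have "eval_rank_ge L n j (v P ` {1..s}) r \<longleftrightarrow> flatten_tuple s L P \<in> ?U" if P: "P \<in> point_tuples s L n" for P
  proof -
    let ?w = "\<lambda>(i, l). v P i l"
    have M: "flatten_tuple s L P \<in> multiproj ?L ?n"
      using bij_betw_flatten_tuple[of s L n] P by (rule bij_betwE[THEN bspec])
    have w: "?w x \<in> flatten_tuple s L P x" if "x \<in> ?L" for x
      using v[OF P] that by (auto simp: flatten_tuple_def)
    have "flatten_tuple s L P \<in> ?U \<longleftrightarrow> (\<exists>D\<in>?F. \<not> vanishes_at ?L D (flatten_tuple s L P))"
      using M unfolding zero_locus_def by blast
    also have "\<dots> \<longleftrightarrow> (\<exists>D\<in>?F. eval_mpoly ?w D \<noteq> 0)"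
      by (rule bex_cong[OF refl]) (use vanishes_at_iff[OF finL M _ w] F in blast)
    also have "\<dots> \<longleftrightarrow> eval_rank_ge L n j ((\<lambda>i l. ?w (i, l)) ` {1..s}) r"
      unfolding eval_rank_ge_iff_minor by blast
    finally show ?thesis by simp
  qed
  then have "{P \<in> point_tuples s L n. eval_rank_ge L n j (v P ` {1..s}) r} =
      flatten_tuple s L -` ?U \<inter> point_tuples s L n"
    by blast
  then show ?thesis
    unfolding zariski_power_def openin_pullback_topology using U by blast
qed

section \<open>Existence\<close>

text \<open>Exponents start at 1 like the indices of the points, which is why the nodes must be
  nonzero.\<close>

lemma vandermonde_trivial_kernel:
  fixes y :: "nat \<Rightarrow> 'a::field"
  assumes "inj_on y {..<r}" "\<And>a. a < r \<Longrightarrow> y a \<noteq> 0" "r \<le> s"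
  shows "trivial_kernel {1..s} r (\<lambda>i a. y a ^ i)"
  unfolding trivial_kernel_def
proof (intro allI impI)
  fix c a assume c: "\<forall>i\<in>{1..s}. (\<Sum>a<r. c a * y a ^ i) = 0" and a: "a < r"
  \<comment> \<open>As in Lagrange interpolation, \<open>p\<close> vanishes at every node except
    \<open>y a\<close>.\<close>
  define p where "p = (\<Prod>b\<in>{..<r} - {a}. [:- y b, 1:])"
  have "degree p \<le> (\<Sum>b\<in>{..<r} - {a}. degree [:- y b, 1:])"
    unfolding p_def using degree_prod_sum_le[of "{..<r} - {a}" "\<lambda>b. [:- y b, 1:]"] by (simp add: o_def)
  also have "\<dots> = r - 1" using a by simp
  finally have deg: "degree p < s" using a assms(3) by simp
  \<comment> \<open>The factor \<open>y b\<close> shifts the exponents \<open>0..degree p\<close> to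
    \<open>1..Suc (degree p)\<close>, within the range of the given equations.\<close>
  have "(\<Sum>b<r. c b * y b * poly p (y b)) = (\<Sum>b<r. \<Sum>i\<le>degree p. coeff p i * (c b * y b ^ Suc i))"
    by (simp add: poly_altdef sum_distrib_left mult_ac)
  also have "\<dots> = (\<Sum>i\<le>degree p. coeff p i * (\<Sum>b<r. c b * y b ^ Suc i))"
    by (subst sum.swap) (simp only: sum_distrib_left)
  also have "\<dots> = 0"
  proof (rule sum.neutral, intro ballI)
    fix i assume "i \<in> {..degree p}"
    then have "Suc i \<in> {1..s}" using deg by simp
    then show "coeff p i * (\<Sum>b<r. c b * y b ^ Suc i) = 0"
      using bspec[OF c] by (simp only: mult_zero_right)
  qed
  finally have "(\<Sum>b<r. c b * y b * poly p (y b)) = 0" .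
  moreover have "poly p (y b) = 0" if "b \<in> {..<r} - {a}" for b
    unfolding p_def poly_prod using that by (intro prod_zero) auto
  then have "(\<Sum>b<r. c b * y b * poly p (y b)) = c a * y a * poly p (y a)"
    using a by (simp add: sum.remove[of "{..<r}" a])
  moreover have "poly p (y a) \<noteq> 0"
    using assms(1) a by (auto simp: p_def poly_prod inj_on_def)
  ultimately show "c a = 0" using assms(2)[OF a] by simp
qed

text \<open>With distinct primes as values of the variables, each exponent is recovered as a
  multiplicity.\<close>

lemma prime_monomial_values:
  assumes "finite V"
  obtains \<pi> :: "'v \<Rightarrow> nat" where "\<And>x. \<pi> x > 0"
    "inj_on (\<lambda>\<mu>. \<Prod>x\<in>Poly_Mapping.keys \<mu>. \<pi> x ^ Poly_Mapping.lookup \<mu> x) {\<mu>. Poly_Mapping.keys \<mu> \<subseteq> V}"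
proof -
  obtain B :: "nat set" where B: "finite B" "card B = card V" "B \<subseteq> {p. prime p}"
    using infinite_arbitrarily_large[OF primes_infinite, of "card V"] by blast
  then obtain h where h: "bij_betw h V B"
    using finite_same_card_bij[OF assms B(1)] by auto
  \<comment> \<open>The value 1 outside \<open>V\<close> only serves to make \<open>\<pi>\<close>
    positive everywhere.\<close>
  define \<pi> where "\<pi> = (\<lambda>x. if x \<in> V then h x else 1)"
  have pr: "prime (\<pi> x)" if "x \<in> V" for x
    using h B(3) that by (auto simp: \<pi>_def bij_betw_def)
  have inj: "inj_on \<pi> V"
    using h by (auto simp: \<pi>_def bij_betw_def inj_on_def)
  have mult: "multiplicity (\<pi> x) (\<Prod>x\<in>Poly_Mapping.keys \<mu>. \<pi> x ^ Poly_Mapping.lookup \<mu> x) = Poly_Mapping.lookup \<mu> x"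
    if \<mu>: "Poly_Mapping.keys \<mu> \<subseteq> V" and x: "x \<in> V" for \<mu> x
  proof -
    have "(\<Prod>x\<in>Poly_Mapping.keys \<mu>. \<pi> x ^ Poly_Mapping.lookup \<mu> x) = (\<Prod>x\<in>V. \<pi> x ^ Poly_Mapping.lookup \<mu> x)"
      by (rule prod.mono_neutral_left) (use \<mu> assms in \<open>auto simp: in_keys_iff\<close>)
    \<comment> \<open>Reindexed by the primes themselves, the product is a prime factorisation whose
      multiplicities can be read off.\<close>
    also have "\<dots> = (\<Prod>y\<in>\<pi> ` V. y ^ Poly_Mapping.lookup \<mu> (inv_into V \<pi> y))"
      by (simp add: prod.reindex[OF inj] inv_into_f_f[OF inj])
    also have "multiplicity (\<pi> x) \<dots> = Poly_Mapping.lookup \<mu> x"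
      using x pr assms by (subst multiplicity_prod_prime_powers) (auto simp: inv_into_f_f[OF inj])
    finally show ?thesis .
  qed
  show thesis
  proof (rule that)
    show "\<pi> x > 0" for x
      using pr[of x] by (cases "x \<in> V") (auto simp: prime_gt_0_nat, simp add: \<pi>_def)
    show "inj_on (\<lambda>\<mu>. \<Prod>x\<in>Poly_Mapping.keys \<mu>. \<pi> x ^ Poly_Mapping.lookup \<mu> x) {\<mu>. Poly_Mapping.keys \<mu> \<subseteq> V}"
    proof (rule inj_onI)
      fix \<mu> \<nu> :: "'v \<Rightarrow>\<^sub>0 nat"
      assume *: "\<mu> \<in> {\<mu>. Poly_Mapping.keys \<mu> \<subseteq> V}" "\<nu> \<in> {\<mu>. Poly_Mapping.keys \<mu> \<subseteq> V}"
        "(\<Prod>x\<in>Poly_Mapping.keys \<mu>. \<pi> x ^ Poly_Mapping.lookup \<mu> x) =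
         (\<Prod>x\<in>Poly_Mapping.keys \<nu>. \<pi> x ^ Poly_Mapping.lookup \<nu> x)"
      show "\<mu> = \<nu>"
      proof (rule poly_mapping_eqI)
        fix x
        show "Poly_Mapping.lookup \<mu> x = Poly_Mapping.lookup \<nu> x"
        proof (cases "x \<in> V")
          case True
          then show ?thesis using mult[of \<mu> x] mult[of \<nu> x] * by simp
        next
          case False
          then have "x \<notin> Poly_Mapping.keys \<mu>" "x \<notin> Poly_Mapping.keys \<nu>" using * by auto
          then show ?thesis by (simp add: in_keys_iff)
        qed
      qed
    qed
  qed
qed

text \<open>A monomial takes the value \<open>q \<mu> ^ i\<close> at \<open>v i\<close>, so any
  \<open>r \<le> s\<close> monomials give a Vandermonde matrix. As \<open>v\<close> does not involve
  \<open>j\<close>, it serves all degrees.\<close>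

lemma eval_rank_ge_geometric:
  fixes L :: "'l set"
  assumes "finite L"
  obtains v :: "nat \<Rightarrow> 'l \<Rightarrow> nat \<Rightarrow> 'a::field_char_0" where
    "\<And>i l. v i l \<in> nonzero_vecs (n l)"
    "\<And>j. eval_rank_ge L n j (v ` {1..s}) (min (ring_hilbert TYPE('a) L n j) s)"
proof -
  obtain \<pi> :: "'l \<times> nat \<Rightarrow> nat" where pos: "\<And>x. \<pi> x > 0" and
    inj: "inj_on (\<lambda>\<mu>. \<Prod>x\<in>Poly_Mapping.keys \<mu>. \<pi> x ^ Poly_Mapping.lookup \<mu> x) {\<mu>. Poly_Mapping.keys \<mu> \<subseteq> vars L n}"
    using prime_monomial_values[OF finite_vars[OF assms, of n]] by blast
  define q where "q = (\<lambda>\<mu>. \<Prod>x\<in>Poly_Mapping.keys \<mu>. \<pi> x ^ Poly_Mapping.lookup \<mu> x)"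
  define v :: "nat \<Rightarrow> 'l \<Rightarrow> nat \<Rightarrow> 'a" where
    "v = (\<lambda>i l m. if m \<le> n l then of_nat (\<pi> (l, m)) ^ i else 0)"
  have "v i l 0 \<noteq> 0" for i l
    using pos[of "(l, 0)"] by (simp add: v_def)
  then have "v i l \<in> nonzero_vecs (n l)" for i l
    unfolding nonzero_vecs_def by (auto simp: v_def)
  moreover have "eval_rank_ge L n j (v ` {1..s}) (min (ring_hilbert TYPE('a) L n j) s)" for j
  proof -
    let ?r = "min (ring_hilbert TYPE('a) L n j) s"
    obtain ms where ms: "set ms = monomials L n j" "distinct ms"
      using finite_distinct_list[OF finite_monomials[OF assms]] by blast
    then have len: "?r \<le> length ms"
      by (metis distinct_card min.cobounded1 ring_hilbert_eq_card[OF assms])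
    have mem: "ms ! a \<in> monomials L n j" if "a < ?r" for a
      using that len ms(1) by (metis nth_mem order_less_le_trans)
    let ?y = "\<lambda>a. of_nat (q (ms ! a)) :: 'a"
    have eval: "eval_mpoly (v i) (Poly_Mapping.single \<mu> 1) = of_nat (q \<mu>) ^ i" if "\<mu> \<in> monomials L n j" for \<mu> i
    proof -
      have "(\<Prod>(l, m)\<in>Poly_Mapping.keys \<mu>. v i l m ^ Poly_Mapping.lookup \<mu> (l, m)) =
          (\<Prod>x\<in>Poly_Mapping.keys \<mu>. (of_nat (\<pi> x) ^ Poly_Mapping.lookup \<mu> x) ^ i)"
        by (rule prod.cong)
           (use that in \<open>auto simp: v_def monomials_def vars_def power_mult[symmetric] mult.commute\<close>)
      also have "\<dots> = of_nat (q \<mu>) ^ i"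
        by (simp add: q_def prod_power_distrib)
      finally show ?thesis by (simp add: eval_mpoly_single)
    qed
    \<comment> \<open>Characteristic 0 reduces equality in the field to equality of natural numbers,
      to which unique factorisation applies.\<close>
    have "inj_on ?y {..<?r}"
    proof (rule inj_onI)
      fix a b assume ab: "a \<in> {..<?r}" "b \<in> {..<?r}" "?y a = ?y b"
      then have "q (ms ! a) = q (ms ! b)" by simp
      moreover have "Poly_Mapping.keys (ms ! a) \<subseteq> vars L n" "Poly_Mapping.keys (ms ! b) \<subseteq> vars L n"
        using mem[of a] mem[of b] ab by (auto simp: monomials_def)
      ultimately have "ms ! a = ms ! b" using inj unfolding q_def inj_on_def by blast
      moreover have "a < length ms" "b < length ms"
        using ab(1,2) less_le_trans[OF _ len] by blast+
      ultimately show "a = b" using ms(2) nth_eq_iff_index_eq by blast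
    qed
    moreover have "?y a \<noteq> 0" for a
      using pos by (simp add: q_def)
    ultimately have "trivial_kernel {1..s} ?r (\<lambda>i a. ?y a ^ i)"
      by (intro vandermonde_trivial_kernel) auto
    then have "trivial_kernel (v ` {1..s}) ?r (\<lambda>w a. eval_mpoly w (Poly_Mapping.single (ms ! a) 1))"
      using mem by (simp add: trivial_kernel_def eval)
    then show ?thesis
      unfolding eval_rank_ge_def
      by (intro exI[of _ "\<lambda>a. Poly_Mapping.single (ms ! a) 1"] conjI allI impI
        monomial_in_graded_piece mem)
  qed
  ultimately show thesis by (rule that)
qed

lemma generic_tuples_open_nonempty:
  fixes L :: "'l set" and n :: "'l \<Rightarrow> nat"
  assumes "finite L" "L \<noteq> {}" "\<And>l. l \<in> L \<Longrightarrow> n l \<ge> 1" "s \<ge> 1"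
  shows "openin (zariski_power s L n)
           {P :: nat \<Rightarrow> 'l \<Rightarrow> (nat \<Rightarrow> 'a::field_char_0) set. generic_tuple s L n P}" (is ?open)
    and "{P :: nat \<Rightarrow> 'l \<Rightarrow> (nat \<Rightarrow> 'a) set. generic_tuple s L n P} \<noteq> {}" (is ?nonempty)
proof -
  let ?T = "point_tuples s L n :: (nat \<Rightarrow> 'l \<Rightarrow> (nat \<Rightarrow> 'a) set) set"
  let ?r = "\<lambda>j. min (ring_hilbert TYPE('a) L n j) s"
  let ?B = "L \<rightarrow>\<^sub>E {..s}"
  \<comment> \<open>An arbitrary choice of coordinates for every point of every tuple.\<close>
  define v where "v = (\<lambda>(P :: nat \<Rightarrow> 'l \<Rightarrow> (nat \<Rightarrow> 'a) set) i l. SOME x. x \<in> P i l)"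
  have v: "v P i l \<in> P i l" if "P \<in> ?T" "i \<in> {1..s}" "l \<in> L" for P i l
  proof -
    have "P i l \<in> proj_space (n l)"
      using that by (auto simp: point_tuples_def multiproj_def PiE_iff)
    then show ?thesis
      unfolding v_def by (metis proj_space_nonempty someI)
  qed
  have iff: "generic_tuple s L n P \<longleftrightarrow> (\<forall>j\<in>?B. eval_rank_ge L n j (v P ` {1..s}) (?r j))" if "P \<in> ?T" for P
    using generic_tuple_iff[OF assms that v[OF that]] .
  have "{P. generic_tuple s L n P} =
      (\<Inter>j\<in>?B. {P \<in> ?T. eval_rank_ge L n j (v P ` {1..s}) (?r j)}) \<inter> topspace (zariski_power s L n)"
    using iff unfolding topspace_zariski_power[OF assms(1)] by (auto simp: generic_tuple_def)
  moreover have "openin (zariski_power s L n) \<dots>"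
  proof (rule openin_INT)
    \<comment> \<open>The bound on the degrees pays off here: a finite intersection of open sets is
      open.\<close>
    show "finite ?B" using assms(1) by (intro finite_PiE) auto
    show "openin (zariski_power s L n) {P \<in> ?T. eval_rank_ge L n j (v P ` {1..s}) (?r j)}" for j
      by (rule openin_eval_rank_ge[where v = v, OF assms(1)]) (rule v)
  qed
  ultimately show ?open by simp
  obtain w :: "nat \<Rightarrow> 'l \<Rightarrow> nat \<Rightarrow> 'a" where w: "\<And>i l. w i l \<in> nonzero_vecs (n l)"
      "\<And>j. eval_rank_ge L n j (w ` {1..s}) (?r j)"
    using eval_rank_ge_geometric[OF assms(1), of n s] by blast
  define P where "P = (\<lambda>i\<in>{1..s}. \<lambda>l\<in>L. proportional (n l) `` {w i l})"
  have "P \<in> ?T"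
    using w(1) by (auto simp: P_def point_tuples_def multiproj_def proj_space_def intro!: quotientI)
  moreover have "w i l \<in> P i l" if "i \<in> {1..s}" "l \<in> L" for i l
    using that w(1)[of i l] by (auto simp: P_def proportional_def intro: exI[of _ 1])
  ultimately have "generic_tuple s L n P"
    using generic_tuple_iff[where P = P and v = w and n = n, OF assms] w(2) by blast
  then show ?nonempty by blast
qed

theorem theorem3p2:
  fixes k s :: nat and n :: "nat \<Rightarrow> nat"
  assumes "k \<ge> 1" and "\<And>l. l \<in> {1..k} \<Longrightarrow> n l \<ge> 1" and "s \<ge> 1"
  shows "openin (zariski_power s {1..k} n)
           {P :: nat \<Rightarrow> nat \<Rightarrow> (nat \<Rightarrow> 'a::{alg_closed_field, field_char_0}) set.
              generic_tuple s {1..k} n P} \<and>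
         {P :: nat \<Rightarrow> nat \<Rightarrow> (nat \<Rightarrow> 'a) set. generic_tuple s {1..k} n P} \<noteq> {}"
  using generic_tuples_open_nonempty[of "{1..k}" n s, where 'a = 'a] assms by auto

end
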